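(* Let $X$ be a space, and let $\underline{X}_\bullet$ be the constant simplicial space on $X$, i.e. $\underline{X}_p=X$ for all $p\in\mathbb{N}$ and $\underline{X}_\bullet(\alpha)=\mathrm{id}_X$ for all $\alpha\colon[p]\to[q]$ in $\Delta$. Then there is an equivalence of categories $$\mathsf{Sh}(X)\simeq\mathsf{Sh}^{\mathrm{s.\,cart}}(\underline{X}_\bullet)$$ between the category of sheaves on $X$ and the category of strictly cartesian sheaves on $\underline{X}_\bullet$.
   Context: Sheaves are sheaves of sets, and $\Delta$ is the simplex category. A simplicial space is a functor $X_\bullet\colon\Delta^{\mathrm{op}}\to\mathsf{Space}$, where $\mathsf{Space}$ is a fixed category of suitably nice spaces (e.g. compactly generated topological spaces); for $\alpha\colon[p]\to[q]$ in $\Delta$ write $X_\bullet\alpha\colon X_q\to X_p$. A sheaf $\mathcal{F}^\bullet$ on $X_\bullet$ is the data of a sheaf $\mathcal{F}^p$ on $X_p$ for all $p\in\mathbb{N}$, with morphisms $\mathcal{F}^\bullet\alpha\colon(X_\bullet\alpha)^*\mathcal{F}^p\to\mathcal{F}^q$ for all $\alpha\colon[p]\to[q]$ in $\Delta$, functorial in the sense that $\mathcal{F}^\bullet(\mathrm{id})=\mathrm{id}$ and $\mathcal{F}^\bullet(\beta\circ\alpha)=\mathcal{F}^\bullet(\beta)\circ\mathcal{F}^\bullet(\alpha)$ (where $\mathcal{F}^\bullet(\alpha)$ is pulled back along $X_\bullet\beta$, and the canonical isomorphisms $(fg)^*\cong g^*f^*$ are used implicitly). A morphism $\varphi^\bullet\colon\mathcal{F}^\bullet\to\mathcal{G}^\bullet$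 is a family of sheaf morphisms $\varphi^p\colon\mathcal{F}^p\to\mathcal{G}^p$ with $\varphi^q\circ\mathcal{F}^\bullet\alpha=\mathcal{G}^\bullet\alpha\circ(X_\bullet\alpha)^*\varphi^p$ for all $\alpha$. The resulting category is $\mathsf{Sh}(X_\bullet)$. A sheaf $\mathcal{F}^\bullet$ on $X_\bullet$ is strictly cartesian if $\mathcal{F}^\bullet\alpha$ is an isomorphism for all $\alpha$ in $\Delta$; $\mathsf{Sh}^{\mathrm{s.\,cart}}(X_\bullet)$ is the full subcategory of $\mathsf{Sh}(X_\bullet)$ on these objects. *)

theory Defs
  imports "HOL-Analysis.Abstract_Topology" "HOL-Library.FuncSet"
begin

section \<open>Categories\<close>

text \<open>
  Arrows do not carry their domain and codomain; homs and composition are indexed by objects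
  instead: \<open>cmp C a b c g f\<close> is the composite of \<open>f \<in> hom C a b\<close> and \<open>g \<in> hom C b c\<close>.
\<close>

record ('o, 'm) cat_data =
  obj :: "'o set"
  hom :: "'o \<Rightarrow> 'o \<Rightarrow> 'm set"
  ident :: "'o \<Rightarrow> 'm"
  cmp :: "'o \<Rightarrow> 'o \<Rightarrow> 'o \<Rightarrow> 'm \<Rightarrow> 'm \<Rightarrow> 'm"

locale category =
  fixes C :: "('o, 'm) cat_data"
  assumes ident_hom: "a \<in> obj C \<Longrightarrow> ident C a \<in> hom C a a"
    and cmp_hom: "\<lbrakk>a \<in> obj C; b \<in> obj C; c \<in> obj C; f \<in> hom C a b; g \<in> hom C b c\<rbrakk>
      \<Longrightarrow> cmp C a b c g f \<in> hom C a c"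
    and cmp_ident_left: "\<lbrakk>a \<in> obj C; b \<in> obj C; f \<in> hom C a b\<rbrakk>
      \<Longrightarrow> cmp C a b b (ident C b) f = f"
    and cmp_ident_right: "\<lbrakk>a \<in> obj C; b \<in> obj C; f \<in> hom C a b\<rbrakk>
      \<Longrightarrow> cmp C a a b f (ident C a) = f"
    and cmp_assoc: "\<lbrakk>a \<in> obj C; b \<in> obj C; c \<in> obj C; d \<in> obj C;
        f \<in> hom C a b; g \<in> hom C b c; h \<in> hom C c d\<rbrakk>
      \<Longrightarrow> cmp C a c d h (cmp C a b c g f) = cmp C a b d (cmp C b c d h g) f"

definition op_cat :: "('o, 'm) cat_data \<Rightarrow> ('o, 'm) cat_data" where
  "op_cat C = \<lparr>obj = obj C, hom = (\<lambda>a b. hom C b a), ident = ident C,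
     cmp = (\<lambda>a b c g f. cmp C c b a f g)\<rparr>"

definition full_subcat :: "('o, 'm) cat_data \<Rightarrow> ('o \<Rightarrow> bool) \<Rightarrow> ('o, 'm) cat_data" where
  "full_subcat C P = C\<lparr>obj := {a \<in> obj C. P a}\<rparr>"

definition iso_in :: "('o, 'm) cat_data \<Rightarrow> 'o \<Rightarrow> 'o \<Rightarrow> 'm \<Rightarrow> bool" where
  "iso_in C a b f \<longleftrightarrow> f \<in> hom C a b \<and>
     (\<exists>g \<in> hom C b a. cmp C a b a g f = ident C a \<and> cmp C b a b f g = ident C b)"

record ('o, 'm, 'p, 'n) functor_data =
  on_obj :: "'o \<Rightarrow> 'p"
  on_hom :: "'o \<Rightarrow> 'o \<Rightarrow> 'm \<Rightarrow> 'n"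

locale cat_functor = C: category C + D: category D
  for C :: "('o, 'm) cat_data" and D :: "('p, 'n) cat_data" +
  fixes F :: "('o, 'm, 'p, 'n) functor_data"
  assumes on_obj_obj: "a \<in> obj C \<Longrightarrow> on_obj F a \<in> obj D"
    and on_hom_hom: "\<lbrakk>a \<in> obj C; b \<in> obj C; f \<in> hom C a b\<rbrakk>
      \<Longrightarrow> on_hom F a b f \<in> hom D (on_obj F a) (on_obj F b)"
    and on_hom_ident: "a \<in> obj C \<Longrightarrow> on_hom F a a (ident C a) = ident D (on_obj F a)"
    and on_hom_cmp: "\<lbrakk>a \<in> obj C; b \<in> obj C; c \<in> obj C; f \<in> hom C a b; g \<in> hom C b c\<rbrakk>
      \<Longrightarrow> on_hom F a c (cmp C a b c g f) =
          cmp D (on_obj F a) (on_obj F b) (on_obj F c) (on_hom F b c g) (on_hom F a b f)"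

definition id_functor :: "('o, 'm, 'o, 'm) functor_data" where
  "id_functor = \<lparr>on_obj = (\<lambda>a. a), on_hom = (\<lambda>a b f. f)\<rparr>"

definition comp_functor ::
  "('p, 'n, 'q, 'k) functor_data \<Rightarrow> ('o, 'm, 'p, 'n) functor_data \<Rightarrow> ('o, 'm, 'q, 'k) functor_data"
  where
  "comp_functor G F = \<lparr>on_obj = (\<lambda>a. on_obj G (on_obj F a)),
     on_hom = (\<lambda>a b f. on_hom G (on_obj F a) (on_obj F b) (on_hom F a b f))\<rparr>"

locale nat_iso = F: cat_functor C D F + G: cat_functor C D G
  for C :: "('o, 'm) cat_data" and D :: "('p, 'n) cat_data"
    and F G :: "('o, 'm, 'p, 'n) functor_data" +
  fixes \<eta> :: "'o \<Rightarrow> 'n"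
  assumes component_iso: "a \<in> obj C \<Longrightarrow> iso_in D (on_obj F a) (on_obj G a) (\<eta> a)"
    and naturality: "\<lbrakk>a \<in> obj C; b \<in> obj C; f \<in> hom C a b\<rbrakk>
      \<Longrightarrow> cmp D (on_obj F a) (on_obj F b) (on_obj G b) (\<eta> b) (on_hom F a b f) =
          cmp D (on_obj F a) (on_obj G a) (on_obj G b) (on_hom G a b f) (\<eta> a)"

definition equivalent_categories :: "('o, 'm) cat_data \<Rightarrow> ('p, 'n) cat_data \<Rightarrow> bool" where
  "equivalent_categories C D \<longleftrightarrow>
     (\<exists>F G \<eta> \<epsilon>. cat_functor C D F \<and> cat_functor D C G \<and>
        nat_iso C C id_functor (comp_functor G F) \<eta> \<and>
        nat_iso D D (comp_functor F G) id_functor \<epsilon>)"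


section \<open>Sheaves of sets on a topological space\<close>

text \<open>
  The sets of sections are subsets of a fixed type \<open>'a\<close>, which plays the role of the universe of
  small sets and is arbitrary throughout. The data are normalised (no sections on non-open sets,
  value \<open>undefined\<close> outside the intended domains), so that equality in HOL of presheaves and of
  morphisms is equality of the mathematical objects.
\<close>

record ('x, 'a) presheaf_data =
  sec :: "'x set \<Rightarrow> 'a set"
  res :: "'x set \<Rightarrow> 'x set \<Rightarrow> 'a \<Rightarrow> 'a"  \<comment> \<open>\<open>res F U V\<close> restricts from \<open>U\<close> to \<open>V \<subseteq> U\<close>\<close>

locale presheaf =
  fixes X :: "'x topology" and F :: "('x, 'a) presheaf_data"
  assumes sec_not_open: "\<not> openin X U \<Longrightarrow> sec F U = {}"
    and res_undefined: "\<not> (openin X U \<and> openin X V \<and> V \<subseteq> U) \<Longrightarrow> res F U V = (\<lambda>_. undefined)"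
    and res_maps: "\<lbrakk>openin X U; openin X V; V \<subseteq> U\<rbrakk> \<Longrightarrow> res F U V \<in> sec F U \<rightarrow>\<^sub>E sec F V"
    and res_id: "\<lbrakk>openin X U; s \<in> sec F U\<rbrakk> \<Longrightarrow> res F U U s = s"
    and res_res: "\<lbrakk>openin X U; openin X V; openin X W; W \<subseteq> V; V \<subseteq> U; s \<in> sec F U\<rbrakk>
      \<Longrightarrow> res F V W (res F U V s) = res F U W s"

locale sheaf = presheaf +
  assumes glue: "\<lbrakk>\<And>U. U \<in> \<U> \<Longrightarrow> openin X U; \<And>U. U \<in> \<U> \<Longrightarrow> s U \<in> sec F U;
      \<And>U V. \<lbrakk>U \<in> \<U>; V \<in> \<U>\<rbrakk> \<Longrightarrow> res F U (U \<inter> V) (s U) = res F V (U \<inter> V) (s V)\<rbrakk>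
      \<Longrightarrow> \<exists>!t. t \<in> sec F (\<Union>\<U>) \<and> (\<forall>U\<in>\<U>. res F (\<Union>\<U>) U t = s U)"

text \<open>Source and target of a morphism may take sections in different types, as is the case for
  the structure maps \<open>f\<^sup>* F \<rightarrow> G\<close> of sheaves on simplicial spaces.\<close>

definition sheaf_hom ::
  "'x topology \<Rightarrow> ('x, 'a) presheaf_data \<Rightarrow> ('x, 'b) presheaf_data \<Rightarrow> ('x set \<Rightarrow> 'a \<Rightarrow> 'b) set" where
  "sheaf_hom X F G = {\<phi> \<in> (\<Pi>\<^sub>E U\<in>{U. openin X U}. sec F U \<rightarrow>\<^sub>E sec G U).
     \<forall>U V s. openin X U \<longrightarrow> openin X V \<longrightarrow> V \<subseteq> U \<longrightarrow> s \<in> sec F U \<longrightarrow>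
       \<phi> V (res F U V s) = res G U V (\<phi> U s)}"

definition sheaf_id :: "'x topology \<Rightarrow> ('x, 'a) presheaf_data \<Rightarrow> 'x set \<Rightarrow> 'a \<Rightarrow> 'a" where
  "sheaf_id X F = (\<lambda>U\<in>{U. openin X U}. \<lambda>s\<in>sec F U. s)"

definition sheaf_comp ::
  "'x topology \<Rightarrow> ('x, 'a) presheaf_data \<Rightarrow> ('x set \<Rightarrow> 'b \<Rightarrow> 'c) \<Rightarrow> ('x set \<Rightarrow> 'a \<Rightarrow> 'b)
    \<Rightarrow> 'x set \<Rightarrow> 'a \<Rightarrow> 'c"  \<comment> \<open>\<open>F\<close> is the source of the composite\<close>
  where
  "sheaf_comp X F \<psi> \<phi> = (\<lambda>U\<in>{U. openin X U}. compose (sec F U) (\<psi> U) (\<phi> U))"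

definition sheaf_iso ::
  "'x topology \<Rightarrow> ('x, 'a) presheaf_data \<Rightarrow> ('x, 'b) presheaf_data \<Rightarrow> ('x set \<Rightarrow> 'a \<Rightarrow> 'b) \<Rightarrow> bool"
  where
  "sheaf_iso X F G \<phi> \<longleftrightarrow> \<phi> \<in> sheaf_hom X F G \<and>
     (\<exists>\<psi> \<in> sheaf_hom X G F. sheaf_comp X F \<psi> \<phi> = sheaf_id X F \<and>
                            sheaf_comp X G \<phi> \<psi> = sheaf_id X G)"

definition Sh :: "'x topology \<Rightarrow> (('x, 'a) presheaf_data, 'x set \<Rightarrow> 'a \<Rightarrow> 'a) cat_data" where
  "Sh X = \<lparr>obj = {F. sheaf X F}, hom = sheaf_hom X, ident = sheaf_id X,
     cmp = (\<lambda>F G H \<psi> \<phi>. sheaf_comp X F \<psi> \<phi>)\<rparr>"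


section \<open>Inverse image\<close>

type_synonym ('x, 'a) germ = "('x set \<times> 'a) set"

definition local_sections ::
  "'x topology \<Rightarrow> ('x, 'a) presheaf_data \<Rightarrow> 'x \<Rightarrow> ('x set \<times> 'a) set" where
  "local_sections X F x = {(U, s). openin X U \<and> x \<in> U \<and> s \<in> sec F U}"

definition germ_rel ::
  "'x topology \<Rightarrow> ('x, 'a) presheaf_data \<Rightarrow> 'x \<Rightarrow> (('x set \<times> 'a) \<times> ('x set \<times> 'a)) set" where
  "germ_rel X F x = {((U, s), (V, t)).
     (U, s) \<in> local_sections X F x \<and> (V, t) \<in> local_sections X F x \<and>
     (\<exists>W. openin X W \<and> x \<in> W \<and> W \<subseteq> U \<inter> V \<and> res F U W s = res F V W t)}"

definition germ :: "'x topology \<Rightarrow> ('x, 'a) presheaf_data \<Rightarrow> 'x \<Rightarrow> 'x set \<Rightarrow> 'a \<Rightarrow> ('x, 'a) germ" where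
  "germ X F x U s = germ_rel X F x `` {(U, s)}"

definition stalk :: "'x topology \<Rightarrow> ('x, 'a) presheaf_data \<Rightarrow> 'x \<Rightarrow> ('x, 'a) germ set" where
  "stalk X F x = local_sections X F x // germ_rel X F x"

text \<open>
  \<open>inv_image Y X f F\<close> is \<open>f\<^sup>* F\<close> for a continuous map \<open>f\<close> from \<open>Y\<close> to \<open>X\<close>: the sheafification of
  \<open>V \<mapsto> colim F U\<close>, the colimit being over the open \<open>U \<supseteq> f V\<close>. The stalk of that presheaf at \<open>y\<close> is
  the stalk of \<open>F\<close> at \<open>f y\<close>, so the sections of the sheafification over \<open>V\<close> are the families of
  germs of \<open>F\<close> at the points \<open>f y\<close>, \<open>y \<in> V\<close>, that are locally given by sections of \<open>F\<close>.
\<close>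

definition inv_image_sec ::
  "'y topology \<Rightarrow> 'x topology \<Rightarrow> ('y \<Rightarrow> 'x) \<Rightarrow> ('x, 'a) presheaf_data \<Rightarrow> 'y set
    \<Rightarrow> ('y \<Rightarrow> ('x, 'a) germ) set" where
  "inv_image_sec Y X f F V = {\<sigma> \<in> (\<Pi>\<^sub>E y\<in>V. stalk X F (f y)). openin Y V \<and>
     (\<forall>y\<in>V. \<exists>W U t. openin Y W \<and> y \<in> W \<and> W \<subseteq> V \<and> openin X U \<and> f ` W \<subseteq> U \<and>
        t \<in> sec F U \<and> (\<forall>z\<in>W. \<sigma> z = germ X F (f z) U t))}"

definition inv_image ::
  "'y topology \<Rightarrow> 'x topology \<Rightarrow> ('y \<Rightarrow> 'x) \<Rightarrow> ('x, 'a) presheaf_data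
    \<Rightarrow> ('y, 'y \<Rightarrow> ('x, 'a) germ) presheaf_data" where
  "inv_image Y X f F = \<lparr>sec = inv_image_sec Y X f F,
     res = (\<lambda>U V. if openin Y U \<and> openin Y V \<and> V \<subseteq> U
                  then (\<lambda>\<sigma>\<in>inv_image_sec Y X f F U. restrict \<sigma> V) else (\<lambda>_. undefined))\<rparr>"

text \<open>Induced maps on stalks are written as the union of the classes of the images of all
  representatives; for a morphism of sheaves all these classes coincide.\<close>

definition stalk_map ::
  "'x topology \<Rightarrow> ('x, 'b) presheaf_data \<Rightarrow> ('x set \<Rightarrow> 'a \<Rightarrow> 'b) \<Rightarrow> 'x \<Rightarrow> ('x, 'a) germ \<Rightarrow> ('x, 'b) germ"
  where
  "stalk_map X G \<phi> x c = (\<Union>(U, s)\<in>c. germ X G x U (\<phi> U s))"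

definition inv_image_map ::
  "'y topology \<Rightarrow> 'x topology \<Rightarrow> ('y \<Rightarrow> 'x) \<Rightarrow> ('x, 'a) presheaf_data \<Rightarrow> ('x, 'b) presheaf_data
    \<Rightarrow> ('x set \<Rightarrow> 'a \<Rightarrow> 'b) \<Rightarrow> 'y set \<Rightarrow> ('y \<Rightarrow> ('x, 'a) germ) \<Rightarrow> ('y \<Rightarrow> ('x, 'b) germ)" where
  "inv_image_map Y X f F G \<phi> =
     (\<lambda>V\<in>{V. openin Y V}. \<lambda>\<sigma>\<in>inv_image_sec Y X f F V. \<lambda>y\<in>V. stalk_map X G \<phi> (f y) (\<sigma> y))"

text \<open>The canonical map \<open>F U \<rightarrow> (f\<^sup>* F) (f\<^sup>-\<^sup>1 U)\<close>.\<close>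

definition inv_image_unit ::
  "'y topology \<Rightarrow> 'x topology \<Rightarrow> ('y \<Rightarrow> 'x) \<Rightarrow> ('x, 'a) presheaf_data \<Rightarrow> 'x set \<Rightarrow> 'a
    \<Rightarrow> ('y \<Rightarrow> ('x, 'a) germ)" where
  "inv_image_unit Y X f F U s = (\<lambda>y\<in>{y \<in> topspace Y. f y \<in> U}. germ X F (f y) U s)"

text \<open>The canonical isomorphism \<open>F \<cong> id\<^sup>* F\<close>.\<close>

definition inv_image_id_iso ::
  "'x topology \<Rightarrow> ('x, 'a) presheaf_data \<Rightarrow> 'x set \<Rightarrow> 'a \<Rightarrow> ('x \<Rightarrow> ('x, 'a) germ)" where
  "inv_image_id_iso X F =
     (\<lambda>U\<in>{U. openin X U}. \<lambda>s\<in>sec F U. inv_image_unit X X (\<lambda>x\<in>topspace X. x) F U s)"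

text \<open>The canonical isomorphism \<open>(f g)\<^sup>* F \<cong> g\<^sup>* (f\<^sup>* F)\<close> for \<open>g\<close> from \<open>Z\<close> to \<open>Y\<close> and \<open>f\<close> from \<open>Y\<close>
  to \<open>X\<close>. At \<open>z\<close> it sends the germ of \<open>s\<close> at \<open>f (g z)\<close> to the germ at \<open>g z\<close> of the section of
  \<open>f\<^sup>* F\<close> defined by \<open>s\<close>.\<close>

definition inv_image_comp_iso ::
  "'z topology \<Rightarrow> 'y topology \<Rightarrow> 'x topology \<Rightarrow> ('z \<Rightarrow> 'y) \<Rightarrow> ('y \<Rightarrow> 'x) \<Rightarrow> ('x, 'a) presheaf_data
    \<Rightarrow> 'z set \<Rightarrow> ('z \<Rightarrow> ('x, 'a) germ) \<Rightarrow> ('z \<Rightarrow> ('y, 'y \<Rightarrow> ('x, 'a) germ) germ)" where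
  "inv_image_comp_iso Z Y X g f F =
     (\<lambda>V\<in>{V. openin Z V}. \<lambda>\<sigma>\<in>inv_image_sec Z X (compose (topspace Z) f g) F V. \<lambda>z\<in>V.
        (\<Union>(U, s)\<in>\<sigma> z. germ Y (inv_image Y X f F) (g z)
           {y \<in> topspace Y. f y \<in> U} (inv_image_unit Y X f F U s)))"


section \<open>Simplicial spaces\<close>

text \<open>The object \<open>[p] = {0, ..., p}\<close> is represented by \<open>p\<close>.\<close>

definition simplex_cat :: "(nat, nat \<Rightarrow> nat) cat_data" where
  "simplex_cat = \<lparr>obj = UNIV, hom = (\<lambda>p q. {\<alpha> \<in> {..p} \<rightarrow>\<^sub>E {..q}. mono_on {..p} \<alpha>}),
     ident = (\<lambda>p. \<lambda>i\<in>{..p}. i), cmp = (\<lambda>p q r \<beta> \<alpha>. compose {..p} \<beta> \<alpha>)\<rparr>"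

text \<open>All topological spaces are admitted. Sheaves on a simplicial space depend only on the
  underlying simplicial object of this category, so this covers every category of nice spaces.\<close>

definition top_cat :: "('x topology, 'x \<Rightarrow> 'x) cat_data" where
  "top_cat = \<lparr>obj = UNIV, hom = (\<lambda>X Y. {f \<in> extensional (topspace X). continuous_map X Y f}),
     ident = (\<lambda>X. \<lambda>x\<in>topspace X. x), cmp = (\<lambda>X Y Z g f. compose (topspace X) g f)\<rparr>"

text \<open>For \<open>\<alpha> : [p] \<rightarrow> [q]\<close> in the simplex category, the map \<open>X\<^sub>q \<rightarrow> X\<^sub>p\<close> is \<open>on_hom X q p \<alpha>\<close>.\<close>

type_synonym 'x simplicial_data = "(nat, nat \<Rightarrow> nat, 'x topology, 'x \<Rightarrow> 'x) functor_data"

abbreviation simplicial_space :: "'x simplicial_data \<Rightarrow> bool" where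
  "simplicial_space X \<equiv> cat_functor (op_cat simplex_cat) top_cat X"

definition const_simplicial :: "'x topology \<Rightarrow> 'x simplicial_data" where
  "const_simplicial X = \<lparr>on_obj = (\<lambda>p. X), on_hom = (\<lambda>q p \<alpha>. \<lambda>x\<in>topspace X. x)\<rparr>"

lemma category_simplex_cat: "category simplex_cat"
proof
  fix p q r :: nat and \<alpha> \<beta>
  assume "\<alpha> \<in> hom simplex_cat p q" "\<beta> \<in> hom simplex_cat q r"
  then show "cmp simplex_cat p q r \<beta> \<alpha> \<in> hom simplex_cat p r"
    by (simp add: simplex_cat_def PiE_iff Pi_iff mono_on_def compose_def)
qed (auto simp: simplex_cat_def mono_on_def compose_def PiE_iff Pi_iff extensional_def fun_eq_iff)

lemma category_op_cat: "category C \<Longrightarrow> category (op_cat C)"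
  unfolding category_def op_cat_def by simp

lemma category_top_cat: "category top_cat"
proof
  fix X Y Z :: "'x topology" and f g
  assume "f \<in> hom top_cat X Y" "g \<in> hom top_cat Y Z"
  then have "continuous_map X Z (g \<circ> f)"
    by (auto simp: top_cat_def intro: continuous_map_compose)
  then have "continuous_map X Z (compose (topspace X) g f)"
    by (rule continuous_map_eq) (simp add: compose_def)
  then show "cmp top_cat X Y Z g f \<in> hom top_cat X Z"
    by (simp add: top_cat_def compose_def)
next
  fix X :: "'x topology"
  have "continuous_map X X (\<lambda>x\<in>topspace X. x)"
    by (rule continuous_map_eq[OF continuous_map_id]) simp
  then show "ident top_cat X \<in> hom top_cat X X"
    by (simp add: top_cat_def)
qed (auto simp: top_cat_def compose_def extensional_def fun_eq_iff continuous_map_def Pi_iff)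

lemma simplicial_space_const: "simplicial_space (const_simplicial X)"
proof -
  interpret T: category top_cat by (rule category_top_cat)
  interpret S: category "op_cat simplex_cat"
    by (rule category_op_cat[OF category_simplex_cat])
  have id: "(\<lambda>x\<in>topspace X. x) \<in> hom top_cat X X"
    using T.ident_hom[of X] by (simp add: top_cat_def)
  show ?thesis
    by unfold_locales (use id in \<open>auto simp: const_simplicial_def op_cat_def top_cat_def
      simplex_cat_def compose_def fun_eq_iff\<close>)
qed


section \<open>Sheaves on a simplicial space\<close>

text \<open>For \<open>\<alpha> : [p] \<rightarrow> [q]\<close>, the morphism from the inverse image of \<open>F\<^sup>p\<close> under \<open>X\<^sub>q \<rightarrow> X\<^sub>p\<close> to \<open>F\<^sup>q\<close>
  is \<open>strmap F p q \<alpha>\<close>.\<close>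

record ('x, 'a) simp_sheaf_data =
  level :: "nat \<Rightarrow> ('x, 'a) presheaf_data"
  strmap :: "nat \<Rightarrow> nat \<Rightarrow> (nat \<Rightarrow> nat) \<Rightarrow> 'x set \<Rightarrow> ('x \<Rightarrow> ('x, 'a) germ) \<Rightarrow> 'a"

definition level_pullback ::
  "'x simplicial_data \<Rightarrow> ('x, 'a) simp_sheaf_data \<Rightarrow> nat \<Rightarrow> nat \<Rightarrow> (nat \<Rightarrow> nat)
    \<Rightarrow> ('x, 'x \<Rightarrow> ('x, 'a) germ) presheaf_data" where
  "level_pullback X F p q \<alpha> = inv_image (on_obj X q) (on_obj X p) (on_hom X q p \<alpha>) (level F p)"

locale simp_sheaf =
  fixes X :: "'x simplicial_data" and F :: "('x, 'a) simp_sheaf_data"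
  assumes level_sheaf: "sheaf (on_obj X p) (level F p)"
    and strmap_undefined: "\<alpha> \<notin> hom simplex_cat p q \<Longrightarrow> strmap F p q \<alpha> = undefined"
    and strmap_hom: "\<alpha> \<in> hom simplex_cat p q
      \<Longrightarrow> strmap F p q \<alpha> \<in> sheaf_hom (on_obj X q) (level_pullback X F p q \<alpha>) (level F q)"
    and strmap_ident:
      "sheaf_comp (on_obj X p) (level F p) (strmap F p p (ident simplex_cat p))
         (inv_image_id_iso (on_obj X p) (level F p)) = sheaf_id (on_obj X p) (level F p)"
    and strmap_cmp: "\<lbrakk>\<alpha> \<in> hom simplex_cat p q; \<beta> \<in> hom simplex_cat q r\<rbrakk>
      \<Longrightarrow> strmap F p r (cmp simplex_cat p q r \<beta> \<alpha>) =
          (let P = level_pullback X F p r (cmp simplex_cat p q r \<beta> \<alpha>) in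
           sheaf_comp (on_obj X r) P (strmap F q r \<beta>)
             (sheaf_comp (on_obj X r) P
               (inv_image_map (on_obj X r) (on_obj X q) (on_hom X r q \<beta>)
                 (level_pullback X F p q \<alpha>) (level F q) (strmap F p q \<alpha>))
               (inv_image_comp_iso (on_obj X r) (on_obj X q) (on_obj X p)
                 (on_hom X r q \<beta>) (on_hom X q p \<alpha>) (level F p))))"

definition simp_sheaf_hom ::
  "'x simplicial_data \<Rightarrow> ('x, 'a) simp_sheaf_data \<Rightarrow> ('x, 'a) simp_sheaf_data
    \<Rightarrow> (nat \<Rightarrow> 'x set \<Rightarrow> 'a \<Rightarrow> 'a) set" where
  "simp_sheaf_hom X F G = {\<phi>.
     (\<forall>p. \<phi> p \<in> sheaf_hom (on_obj X p) (level F p) (level G p)) \<and>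
     (\<forall>p q. \<forall>\<alpha>\<in>hom simplex_cat p q.
        sheaf_comp (on_obj X q) (level_pullback X F p q \<alpha>) (\<phi> q) (strmap F p q \<alpha>) =
        sheaf_comp (on_obj X q) (level_pullback X F p q \<alpha>) (strmap G p q \<alpha>)
          (inv_image_map (on_obj X q) (on_obj X p) (on_hom X q p \<alpha>) (level F p) (level G p) (\<phi> p)))}"

definition Sh_simp ::
  "'x simplicial_data \<Rightarrow> (('x, 'a) simp_sheaf_data, nat \<Rightarrow> 'x set \<Rightarrow> 'a \<Rightarrow> 'a) cat_data" where
  "Sh_simp X = \<lparr>obj = {F. simp_sheaf X F}, hom = simp_sheaf_hom X,
     ident = (\<lambda>F p. sheaf_id (on_obj X p) (level F p)),
     cmp = (\<lambda>F G H \<psi> \<phi> p. sheaf_comp (on_obj X p) (level F p) (\<psi> p) (\<phi> p))\<rparr>"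

definition strictly_cartesian :: "'x simplicial_data \<Rightarrow> ('x, 'a) simp_sheaf_data \<Rightarrow> bool" where
  "strictly_cartesian X F \<longleftrightarrow> (\<forall>p q. \<forall>\<alpha>\<in>hom simplex_cat p q.
     sheaf_iso (on_obj X q) (level_pullback X F p q \<alpha>) (level F q) (strmap F p q \<alpha>))"

definition Sh_scart ::
  "'x simplicial_data \<Rightarrow> (('x, 'a) simp_sheaf_data, nat \<Rightarrow> 'x set \<Rightarrow> 'a \<Rightarrow> 'a) cat_data" where
  "Sh_scart X = full_subcat (Sh_simp X) (strictly_cartesian X)"

end

theory Submission
  imports Defs
begin

text \<open>
  The canonical isomorphism \<open>u : A \<cong> id\<^sup>* A\<close> turns the structure maps \<open>id\<^sup>* F\<^sup>p \<rightarrow> F\<^sup>q\<close> of a sheaf on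
  the constant simplicial space into maps \<open>F\<^sup>p \<rightarrow> F\<^sup>q\<close>, i.e. such a sheaf is a cosimplicial sheaf
  on \<open>X\<close>. If all these maps are invertible, the map \<open>F\<^sup>0 \<rightarrow> F\<^sup>p\<close> induced by \<open>\<alpha> : [0] \<rightarrow> [p]\<close> does
  not depend on \<open>\<alpha>\<close>, since it is right inverse to the one induced by the unique \<open>[p] \<rightarrow> [0]\<close>.
  These maps form a natural isomorphism from the constant sheaf on \<open>F\<^sup>0\<close> to \<open>F\<close>.
\<close>

section \<open>Morphisms of sheaves\<close>

lemma sheaf_hom_in:
  assumes "\<phi> \<in> sheaf_hom X F G" "openin X U" "s \<in> sec F U"
  shows "\<phi> U s \<in> sec G U"
  using assms by (auto simp: sheaf_hom_def PiE_iff Pi_iff)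

lemma sheaf_hom_res:
  assumes "\<phi> \<in> sheaf_hom X F G" "openin X U" "openin X V" "V \<subseteq> U" "s \<in> sec F U"
  shows "\<phi> V (res F U V s) = res G U V (\<phi> U s)"
  using assms by (auto simp: sheaf_hom_def)

text \<open>Morphisms are \<open>undefined\<close> on non-open sets and off \<open>sec F U\<close>,
  so agreement on sections is already equality in HOL.\<close>

lemma sheaf_hom_eqI:
  assumes "\<phi> \<in> sheaf_hom X F G" "\<psi> \<in> sheaf_hom X F H"
    and eq: "\<And>U s. openin X U \<Longrightarrow> s \<in> sec F U \<Longrightarrow> \<phi> U s = \<psi> U s"
  shows "\<phi> = \<psi>"
proof (intro ext)
  fix U s
  show "\<phi> U s = \<psi> U s"
  proof (cases "openin X U \<and> s \<in> sec F U")
    case False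
    with assms(1,2) show ?thesis
      by (cases "openin X U") (auto simp: sheaf_hom_def PiE_iff extensional_def)
  qed (simp add: eq)
qed

lemma sheaf_homI:
  assumes "\<And>U. \<not> openin X U \<Longrightarrow> \<phi> U = undefined"
    and "\<And>U s. openin X U \<Longrightarrow> s \<notin> sec F U \<Longrightarrow> \<phi> U s = undefined"
    and "\<And>U s. openin X U \<Longrightarrow> s \<in> sec F U \<Longrightarrow> \<phi> U s \<in> sec G U"
    and "\<And>U V s. openin X U \<Longrightarrow> openin X V \<Longrightarrow> V \<subseteq> U \<Longrightarrow> s \<in> sec F U
      \<Longrightarrow> \<phi> V (res F U V s) = res G U V (\<phi> U s)"
  shows "\<phi> \<in> sheaf_hom X F G"
  using assms by (auto simp: sheaf_hom_def PiE_iff extensional_def)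

lemma sheaf_comp_apply:
  "openin X U \<Longrightarrow> s \<in> sec F U \<Longrightarrow> sheaf_comp X F \<psi> \<phi> U s = \<psi> U (\<phi> U s)"
  by (simp add: sheaf_comp_def compose_def)

lemma sheaf_id_apply: "openin X U \<Longrightarrow> s \<in> sec F U \<Longrightarrow> sheaf_id X F U s = s"
  by (simp add: sheaf_id_def)

text \<open>Both composites are cut off to the open sets and to \<open>sec F U\<close>, so only
  values on sections count. Commuting squares are later checked in this pointwise form.\<close>

lemma sheaf_comp_eq_iff:
  "sheaf_comp X F \<psi> \<phi> = sheaf_comp X F \<psi>' \<phi>' \<longleftrightarrow>
     (\<forall>U s. openin X U \<longrightarrow> s \<in> sec F U \<longrightarrow> \<psi> U (\<phi> U s) = \<psi>' U (\<phi>' U s))"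
  by (auto simp: sheaf_comp_def compose_def fun_eq_iff restrict_def)

lemma sheaf_comp_eq_id_iff:
  "sheaf_comp X F \<psi> \<phi> = sheaf_id X F \<longleftrightarrow>
     (\<forall>U s. openin X U \<longrightarrow> s \<in> sec F U \<longrightarrow> \<psi> U (\<phi> U s) = s)"
  by (auto simp: sheaf_comp_def sheaf_id_def compose_def fun_eq_iff restrict_def)

lemma (in presheaf) res_in:
  "openin X U \<Longrightarrow> openin X V \<Longrightarrow> V \<subseteq> U \<Longrightarrow> s \<in> sec F U \<Longrightarrow> res F U V s \<in> sec F V"
  using res_maps by (auto simp: PiE_iff)

lemma (in presheaf) sheaf_id_hom: "sheaf_id X F \<in> sheaf_hom X F F"
  by (rule sheaf_homI) (auto simp: sheaf_id_def res_in)

lemma sheaf_comp_hom: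
  assumes "presheaf X F" "\<phi> \<in> sheaf_hom X F G" "\<psi> \<in> sheaf_hom X G H"
  shows "sheaf_comp X F \<psi> \<phi> \<in> sheaf_hom X F H"
proof -
  interpret presheaf X F by fact
  show ?thesis
    by (rule sheaf_homI)
      (use assms in \<open>auto simp: sheaf_comp_apply res_in sheaf_hom_in sheaf_hom_res,
        auto simp: sheaf_comp_def compose_def\<close>)
qed

section \<open>Morphisms bijective on sections\<close>

definition sheaf_inv ::
  "'x topology \<Rightarrow> ('x, 'a) presheaf_data \<Rightarrow> ('x, 'b) presheaf_data \<Rightarrow> ('x set \<Rightarrow> 'a \<Rightarrow> 'b)
    \<Rightarrow> 'x set \<Rightarrow> 'b \<Rightarrow> 'a" where
  "sheaf_inv X F G \<phi> = (\<lambda>U\<in>{U. openin X U}. \<lambda>s\<in>sec G U. inv_into (sec F U) (\<phi> U) s)"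

text \<open>Working form of isomorphism: bijectivity over each open set can be verified without
  exhibiting an inverse morphism. The types of sections may differ, as they do for \<open>F\<close>
  and \<open>id^* F\<close>.\<close>

locale bij_sheaf_hom = F: presheaf X F + G: presheaf X G
  for X :: "'x topology" and F :: "('x, 'a) presheaf_data" and G :: "('x, 'b) presheaf_data" +
  fixes \<phi> :: "'x set \<Rightarrow> 'a \<Rightarrow> 'b"
  assumes hom: "\<phi> \<in> sheaf_hom X F G"
    and bij: "openin X U \<Longrightarrow> bij_betw (\<phi> U) (sec F U) (sec G U)"
begin

lemma inv_left: "openin X U \<Longrightarrow> s \<in> sec F U \<Longrightarrow> sheaf_inv X F G \<phi> U (\<phi> U s) = s"
  using bij[of U] by (auto simp: sheaf_inv_def bij_betw_def)

lemma inv_right: "openin X U \<Longrightarrow> s \<in> sec G U \<Longrightarrow> \<phi> U (sheaf_inv X F G \<phi> U s) = s"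
  using bij[of U] by (auto simp: sheaf_inv_def bij_betw_def f_inv_into_f)

lemma inv_in: "openin X U \<Longrightarrow> s \<in> sec G U \<Longrightarrow> sheaf_inv X F G \<phi> U s \<in> sec F U"
  using bij[of U] by (auto simp: sheaf_inv_def bij_betw_def inv_into_into)

lemma inv_hom: "sheaf_inv X F G \<phi> \<in> sheaf_hom X G F"
proof (rule sheaf_homI)
  fix U V s
  assume *: "openin X U" "openin X V" "V \<subseteq> U" "s \<in> sec G U"
  \<comment> \<open>Compatibility with restriction is first shown after applying
    \<open>\<phi> V\<close>, which \<open>inv_left\<close> then cancels.\<close>
  have "\<phi> V (res F U V (sheaf_inv X F G \<phi> U s)) = res G U V s"
    using * by (simp add: sheaf_hom_res[OF hom] inv_in inv_right)
  then show "sheaf_inv X F G \<phi> V (res G U V s) = res F U V (sheaf_inv X F G \<phi> U s)"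
    using * by (metis F.res_in inv_in inv_left)
qed (auto simp: inv_in, auto simp: sheaf_inv_def)

lemma iso: "sheaf_iso X F G \<phi>"
  unfolding sheaf_iso_def sheaf_comp_eq_id_iff
  using hom inv_hom inv_left inv_right by blast

lemma inv_bij_sheaf_hom: "bij_sheaf_hom X G F (sheaf_inv X F G \<phi>)"
proof
  fix U assume "openin X U"
  then show "bij_betw (sheaf_inv X F G \<phi> U) (sec G U) (sec F U)"
    by (intro bij_betw_byWitness[where f' = "\<phi> U"])
      (auto simp: inv_left inv_right inv_in sheaf_hom_in[OF hom])
qed (rule inv_hom)

end

lemma sheaf_iso_bij:
  assumes "sheaf_iso X F G \<phi>" "openin X U"
  shows "bij_betw (\<phi> U) (sec F U) (sec G U)"
proof -
  obtain \<psi> where "\<psi> \<in> sheaf_hom X G F" "\<phi> \<in> sheaf_hom X F G"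
      "\<And>s. s \<in> sec F U \<Longrightarrow> \<psi> U (\<phi> U s) = s" "\<And>s. s \<in> sec G U \<Longrightarrow> \<phi> U (\<psi> U s) = s"
    using assms by (auto simp: sheaf_iso_def sheaf_comp_eq_id_iff)
  then show ?thesis
    using assms(2)
    by (intro bij_betw_byWitness[where f' = "\<psi> U"]) (auto simp: sheaf_hom_in)
qed

lemma category_Sh: "category (Sh X)"
proof
  fix F G assume "F \<in> obj (Sh X)"
  then interpret sheaf X F by (simp add: Sh_def)
  show "ident (Sh X) F \<in> hom (Sh X) F F"
    using sheaf_id_hom by (simp add: Sh_def)
  fix f assume f: "f \<in> hom (Sh X) F G"
  assume "G \<in> obj (Sh X)"
  then interpret G: sheaf X G by (simp add: Sh_def)
  have f: "f \<in> sheaf_hom X F G"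
    using f by (simp add: Sh_def)
  show "cmp (Sh X) F G G (ident (Sh X) G) f = f"
    unfolding Sh_def cat_data.simps
    by (rule sheaf_hom_eqI[OF sheaf_comp_hom[OF presheaf_axioms f G.sheaf_id_hom] f])
      (simp add: sheaf_comp_apply sheaf_id_apply sheaf_hom_in[OF f])
  show "cmp (Sh X) F F G f (ident (Sh X) F) = f"
    unfolding Sh_def cat_data.simps
    by (rule sheaf_hom_eqI[OF sheaf_comp_hom[OF presheaf_axioms sheaf_id_hom f] f])
      (simp add: sheaf_comp_apply sheaf_id_apply)
next
  fix F G H f g
  assume "F \<in> obj (Sh X)" "f \<in> hom (Sh X) F G" "g \<in> hom (Sh X) G H"
  then show "cmp (Sh X) F G H g f \<in> hom (Sh X) F H"
    by (auto simp: Sh_def sheaf_def intro: sheaf_comp_hom)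
next
  fix F G H K f g h
  assume "f \<in> hom (Sh X) F G"
  then show "cmp (Sh X) F H K h (cmp (Sh X) F G H g f) = cmp (Sh X) F G K (cmp (Sh X) G H K h g) f"
    by (auto simp: Sh_def sheaf_comp_eq_iff sheaf_comp_apply sheaf_hom_in)
qed


section \<open>Inverse image under the identity\<close>

context presheaf
begin

lemma equiv_germ_rel: "equiv (local_sections X F x) (germ_rel X F x)"
proof (rule equivI)
  show "refl_on (local_sections X F x) (germ_rel X F x)"
    by (auto simp: refl_on_def germ_rel_def local_sections_def)
  show "germ_rel X F x \<subseteq> local_sections X F x \<times> local_sections X F x"
    by (auto simp: germ_rel_def)
  show "sym (germ_rel X F x)"
  proof (rule symI, clarify)
    fix U s V t
    assume "((U, s), (V, t)) \<in> germ_rel X F x"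
    then show "((V, t), (U, s)) \<in> germ_rel X F x"
      unfolding germ_rel_def by (simp add: Int_commute) metis
  qed
  show "trans (germ_rel X F x)"
  proof (rule transI, clarify)
    fix U s V t W r
    assume "((U, s), (V, t)) \<in> germ_rel X F x" "((V, t), (W, r)) \<in> germ_rel X F x"
    then obtain A B where A: "openin X A" "x \<in> A" "A \<subseteq> U \<inter> V" "res F U A s = res F V A t"
      and B: "openin X B" "x \<in> B" "B \<subseteq> V \<inter> W" "res F V B t = res F W B r"
      and ls: "(U, s) \<in> local_sections X F x" "(V, t) \<in> local_sections X F x"
        "(W, r) \<in> local_sections X F x"
      by (auto simp: germ_rel_def)
    have o: "openin X U" "openin X V" "openin X W" "s \<in> sec F U" "t \<in> sec F V" "r \<in> sec F W"
      using ls by (auto simp: local_sections_def)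
    \<comment> \<open>Transitivity is witnessed on \<open>A \<inter> B\<close>, where all three
      sections have the same restriction.\<close>
    have AB: "openin X (A \<inter> B)"
      using A B by auto
    have "res F U (A \<inter> B) s = res F A (A \<inter> B) (res F U A s)"
      using o A AB by (subst res_res) auto
    also have "\<dots> = res F V (A \<inter> B) t"
      using o A AB by (simp, subst res_res) auto
    also have "\<dots> = res F B (A \<inter> B) (res F V B t)"
      using o B AB by (subst res_res) auto
    also have "\<dots> = res F W (A \<inter> B) r"
      using o B AB by (simp, subst res_res) auto
    finally have "\<exists>C. openin X C \<and> x \<in> C \<and> C \<subseteq> U \<inter> W \<and> res F U C s = res F W C r"
      using A B AB by (intro exI[of _ "A \<inter> B"]) auto
    then show "((U, s), (W, r)) \<in> germ_rel X F x"
      using ls by (simp add: germ_rel_def)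
  qed
qed

lemma germ_eq_iff:
  assumes "openin X U" "s \<in> sec F U" "openin X V" "t \<in> sec F V" "x \<in> U" "x \<in> V"
  shows "germ X F x U s = germ X F x V t \<longleftrightarrow>
    (\<exists>W. openin X W \<and> x \<in> W \<and> W \<subseteq> U \<inter> V \<and> res F U W s = res F V W t)"
proof -
  have "germ X F x U s = germ X F x V t \<longleftrightarrow> ((U, s), (V, t)) \<in> germ_rel X F x"
    unfolding germ_def using assms
    by (intro eq_equiv_class_iff[OF equiv_germ_rel]) (auto simp: local_sections_def)
  then show ?thesis
    using assms by (auto simp: germ_rel_def local_sections_def)
qed

lemma germ_res:
  assumes "openin X U" "openin X V" "V \<subseteq> U" "s \<in> sec F U" "x \<in> V"
  shows "germ X F x V (res F U V s) = germ X F x U s"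
proof -
  have "res F V V (res F U V s) = res F U V s"
    using assms by (simp add: res_id res_in)
  then show ?thesis
    using assms by (subst germ_eq_iff) (auto simp: res_in intro!: exI[of _ V])
qed

lemma germ_in_stalk:
  assumes "openin X U" "s \<in> sec F U" "x \<in> U"
  shows "germ X F x U s \<in> stalk X F x"
  using assms by (auto simp: germ_def stalk_def local_sections_def intro!: quotientI)

lemma in_germ_iff:
  assumes "openin X U" "s \<in> sec F U" "x \<in> U"
  shows "(V, t) \<in> germ X F x U s \<longleftrightarrow> openin X V \<and> x \<in> V \<and> t \<in> sec F V \<and>
    (\<exists>W. openin X W \<and> x \<in> W \<and> W \<subseteq> U \<inter> V \<and> res F U W s = res F V W t)"
  using assms by (auto simp: germ_def germ_rel_def local_sections_def)

text \<open>Representatives of one germ agree on a neighbourhood of \<open>x\<close>, hence so do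
  their images under \<open>\<phi>\<close>. All classes in the union defining
  \<open>stalk_map\<close> therefore coincide.\<close>

lemma stalk_map_germ:
  assumes "presheaf X G" "\<phi> \<in> sheaf_hom X F G" "openin X U" "s \<in> sec F U" "x \<in> U"
  shows "stalk_map X G \<phi> x (germ X F x U s) = germ X G x U (\<phi> U s)"
proof -
  interpret G: presheaf X G by fact
  have "germ X G x V (\<phi> V t) = germ X G x U (\<phi> U s)" if Vt: "(V, t) \<in> germ X F x U s" for V t
  proof -
    obtain W where W: "openin X V" "x \<in> V" "t \<in> sec F V" "openin X W" "x \<in> W" "W \<subseteq> U \<inter> V"
        "res F U W s = res F V W t"
      using Vt assms by (auto simp: in_germ_iff)
    then have "res G V W (\<phi> V t) = res G U W (\<phi> U s)"
      using assms by (metis Int_subset_iff sheaf_hom_res)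
    then show ?thesis
      using W assms by (subst G.germ_eq_iff) (auto simp: sheaf_hom_in)
  qed
  \<comment> \<open>The union must be over a nonempty family; \<open>(U, s)\<close> represents its
    own germ.\<close>
  moreover have "(U, s) \<in> germ X F x U s"
    using assms by (auto simp: in_germ_iff)
  ultimately show ?thesis
    unfolding stalk_map_def by fast
qed

end

text \<open>This is the identity arrow of \<open>top_cat\<close>, hence \<open>undefined\<close> off
  \<open>topspace X\<close>; it fixes the points of every open set.\<close>

abbreviation idm :: "'x topology \<Rightarrow> 'x \<Rightarrow> 'x" where
  "idm X \<equiv> \<lambda>x\<in>topspace X. x"

abbreviation id_inv_image ::
  "'x topology \<Rightarrow> ('x, 'a) presheaf_data \<Rightarrow> ('x, 'x \<Rightarrow> ('x, 'a) germ) presheaf_data" where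
  "id_inv_image X F \<equiv> inv_image X X (idm X) F"

lemma openin_idm_preimage: "openin X U \<Longrightarrow> {y \<in> topspace X. idm X y \<in> U} = U"
  by (auto dest: openin_subset)

lemma openin_idm_apply: "openin X U \<Longrightarrow> y \<in> U \<Longrightarrow> idm X y = y"
  by (auto dest: openin_subset)

lemma sec_id_inv_image_not_open: "\<not> openin X U \<Longrightarrow> sec (id_inv_image X F) U = {}"
  by (simp add: inv_image_def inv_image_sec_def)

lemma inv_image_unit_idm:
  "openin X U \<Longrightarrow> s \<in> sec F U \<Longrightarrow> inv_image_unit X X (idm X) F U s = inv_image_id_iso X F U s"
  by (simp add: inv_image_id_iso_def)

lemma inv_image_id_iso_apply:
  assumes "openin X U" "s \<in> sec F U"
  shows "inv_image_id_iso X F U s = (\<lambda>y\<in>U. germ X F y U s)"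
  using assms
  by (simp add: inv_image_id_iso_def inv_image_unit_def openin_idm_preimage)
    (auto simp: restrict_def fun_eq_iff dest: openin_subset)

section \<open>Sections of the inverse image under the identity\<close>

context presheaf
begin

text \<open>The definition of \<open>inv_image_sec\<close> has a neighbourhood \<open>W\<close> in
  the source and an open \<open>U\<close> in the target containing its image. For the identity
  \<open>W \<subseteq> U\<close>, and restricting \<open>t\<close> to \<open>W\<close> changes no
  germ over \<open>W\<close>, so a single open set serves both purposes.\<close>

lemma sec_id_inv_image_iff:
  assumes V: "openin X V"
  shows "\<sigma> \<in> sec (id_inv_image X F) V \<longleftrightarrow> \<sigma> \<in> extensional V \<and>
    (\<forall>y\<in>V. \<exists>W t. openin X W \<and> y \<in> W \<and> W \<subseteq> V \<and> t \<in> sec F W \<and> (\<forall>z\<in>W. \<sigma> z = germ X F z W t))"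
    (is "?l \<longleftrightarrow> ?r")
proof
  assume l: ?l
  have "\<exists>W t. openin X W \<and> y \<in> W \<and> W \<subseteq> V \<and> t \<in> sec F W \<and> (\<forall>z\<in>W. \<sigma> z = germ X F z W t)"
    if y: "y \<in> V" for y
  proof -
    obtain W U t where W: "openin X W" "y \<in> W" "W \<subseteq> V" "openin X U" "idm X ` W \<subseteq> U"
        "t \<in> sec F U" "\<forall>z\<in>W. \<sigma> z = germ X F (idm X z) U t"
      using l y unfolding inv_image_def inv_image_sec_def by simp blast
    have "W \<subseteq> U"
      using W(5) openin_idm_apply[OF W(1)] by (metis image_subset_iff subsetI)
    then have "\<forall>z\<in>W. \<sigma> z = germ X F z W (res F U W t)" "res F U W t \<in> sec F W"
      using W openin_idm_apply[OF W(1)] by (auto simp: germ_res res_in)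
    with W show ?thesis by blast
  qed
  then show ?r
    using l by (auto simp: inv_image_def inv_image_sec_def PiE_iff)
next
  assume r: ?r
  have "\<sigma> y \<in> stalk X F (idm X y)" if "y \<in> V" for y
    using r that by (metis germ_in_stalk openin_idm_apply)
  moreover have "\<exists>W U t. openin X W \<and> y \<in> W \<and> W \<subseteq> V \<and> openin X U \<and> idm X ` W \<subseteq> U \<and>
      t \<in> sec F U \<and> (\<forall>z\<in>W. \<sigma> z = germ X F (idm X z) U t)" if y: "y \<in> V" for y
  proof -
    obtain W t where W: "openin X W" "y \<in> W" "W \<subseteq> V" "t \<in> sec F W"
        "\<forall>z\<in>W. \<sigma> z = germ X F z W t"
      using r y by blast
    have "idm X ` W \<subseteq> W" "\<forall>z\<in>W. \<sigma> z = germ X F (idm X z) W t"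
      using W openin_idm_apply[OF W(1)] by auto
    with W show ?thesis by blast
  qed
  ultimately show ?l
    using r V by (simp add: inv_image_def inv_image_sec_def PiE_iff)
qed

lemma res_id_inv_image:
  assumes "openin X U" "openin X V" "V \<subseteq> U" "\<sigma> \<in> sec (id_inv_image X F) U"
  shows "res (id_inv_image X F) U V \<sigma> = restrict \<sigma> V"
  using assms by (simp add: inv_image_def)

lemma restrict_id_inv_image:
  assumes "openin X U" "openin X V" "V \<subseteq> U" "\<sigma> \<in> sec (id_inv_image X F) U"
  shows "restrict \<sigma> V \<in> sec (id_inv_image X F) V"
  unfolding sec_id_inv_image_iff[OF assms(2)]
proof (intro conjI ballI)
  fix y assume y: "y \<in> V"
  then obtain W t where W: "openin X W" "y \<in> W" "W \<subseteq> U" "t \<in> sec F W"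
      "\<forall>z\<in>W. \<sigma> z = germ X F z W t"
    using assms(3,4) unfolding sec_id_inv_image_iff[OF assms(1)] by blast
  have "openin X (W \<inter> V)"
    using W assms by auto
  moreover from this have "res F W (W \<inter> V) t \<in> sec F (W \<inter> V)"
      "\<forall>z\<in>W \<inter> V. restrict \<sigma> V z = germ X F z (W \<inter> V) (res F W (W \<inter> V) t)"
    using W by (auto simp: germ_res res_in)
  ultimately show "\<exists>W t. openin X W \<and> y \<in> W \<and> W \<subseteq> V \<and> t \<in> sec F W \<and>
      (\<forall>z\<in>W. restrict \<sigma> V z = germ X F z W t)"
    using W y by (intro exI[of _ "W \<inter> V"] exI[of _ "res F W (W \<inter> V) t"]) auto
qed simp

text \<open>Germs of \<open>id^* F\<close> itself occur in \<open>inv_image_comp_iso\<close>; this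
  makes the facts about germs and stalk maps available for them.\<close>

lemma presheaf_id_inv_image: "presheaf X (id_inv_image X F)"
proof
  fix U V
  assume "\<not> (openin X U \<and> openin X V \<and> V \<subseteq> U)"
  then show "res (id_inv_image X F) U V = (\<lambda>_. undefined)"
    unfolding inv_image_def by (simp only: presheaf_data.simps if_False)
next
  fix U V
  assume *: "openin X U" "openin X V" "V \<subseteq> U"
  show "res (id_inv_image X F) U V \<in> sec (id_inv_image X F) U \<rightarrow>\<^sub>E sec (id_inv_image X F) V"
    unfolding PiE_iff
  proof (intro conjI ballI)
    fix \<sigma> assume "\<sigma> \<in> sec (id_inv_image X F) U"
    with * show "res (id_inv_image X F) U V \<sigma> \<in> sec (id_inv_image X F) V"
      by (simp only: res_id_inv_image restrict_id_inv_image)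
  next
    show "res (id_inv_image X F) U V \<in> extensional (sec (id_inv_image X F) U)"
      using * by (simp add: inv_image_def)
  qed
next
  fix U \<sigma>
  assume *: "openin X U" "\<sigma> \<in> sec (id_inv_image X F) U"
  then have "\<sigma> \<in> extensional U"
    by (simp add: sec_id_inv_image_iff del: restrict_apply)
  with * show "res (id_inv_image X F) U U \<sigma> = \<sigma>"
    by (simp add: res_id_inv_image extensional_restrict)
next
  fix U V W \<sigma>
  assume *: "openin X U" "openin X V" "openin X W" "W \<subseteq> V" "V \<subseteq> U" "\<sigma> \<in> sec (id_inv_image X F) U"
  then have "V \<inter> W = W" "W \<subseteq> U" by auto
  with * show "res (id_inv_image X F) V W (res (id_inv_image X F) U V \<sigma>) =
      res (id_inv_image X F) U W \<sigma>"
    by (simp add: res_id_inv_image restrict_id_inv_image)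
qed (rule sec_id_inv_image_not_open)

lemma inv_image_id_iso_hom: "inv_image_id_iso X F \<in> sheaf_hom X F (id_inv_image X F)"
proof (rule sheaf_homI)
  fix U s assume Us: "openin X U" "s \<in> sec F U"
  then show *: "inv_image_id_iso X F U s \<in> sec (id_inv_image X F) U"
    unfolding sec_id_inv_image_iff[OF Us(1)] inv_image_id_iso_apply[OF Us] by auto
  fix V assume V: "openin X V" "V \<subseteq> U"
  then have "U \<inter> V = V" by auto
  with Us V * show "inv_image_id_iso X F V (res F U V s) =
      res (id_inv_image X F) U V (inv_image_id_iso X F U s)"
    by (simp add: res_id_inv_image)
      (auto simp: inv_image_id_iso_apply res_in germ_res fun_eq_iff)
qed (auto simp: inv_image_id_iso_def)

text \<open>At every point the stalk map carries the germ of \<open>s\<close> to that of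
  \<open>\<phi> U s\<close>. This is the naturality of \<open>u\<close>, by which
  \<open>id^* \<phi>\<close> is traded for \<open>\<phi>\<close> in the conditions on simplicial
  sheaves.\<close>

lemma inv_image_map_id_iso:
  assumes "presheaf X G" "\<phi> \<in> sheaf_hom X F G" "openin X U" "s \<in> sec F U"
  shows "inv_image_map X X (idm X) F G \<phi> U (inv_image_id_iso X F U s) =
    inv_image_id_iso X G U (\<phi> U s)"
proof -
  have "inv_image_id_iso X F U s \<in> inv_image_sec X X (idm X) F U"
    using sheaf_hom_in[OF inv_image_id_iso_hom assms(3,4)] by (simp add: inv_image_def)
  moreover have "\<phi> U s \<in> sec G U"
    using assms by (simp add: sheaf_hom_in)
  ultimately show ?thesis
    using assms(3,4)
    by (simp add: inv_image_map_def inv_image_id_iso_apply)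
      (auto simp: fun_eq_iff restrict_def stalk_map_germ[OF assms] dest: openin_subset)
qed

text \<open>For identity maps the union in \<open>inv_image_comp_iso\<close> at \<open>z\<close> is
  the stalk map of \<open>u\<close> applied to the germ of \<open>s\<close>. So on sections coming
  from \<open>F\<close> the coherence isomorphism just applies \<open>u\<close> once more.\<close>

lemma inv_image_comp_iso_id_iso:
  assumes U: "openin X U" "s \<in> sec F U"
  shows "inv_image_comp_iso X X X (idm X) (idm X) F U (inv_image_id_iso X F U s) =
    inv_image_id_iso X (id_inv_image X F) U (inv_image_id_iso X F U s)"
proof -
  let ?u = "inv_image_id_iso X F" and ?I = "id_inv_image X F"
  have u: "?u U s \<in> sec ?I U"
    using sheaf_hom_in[OF inv_image_id_iso_hom U] .
  \<comment> \<open>The coherence isomorphism starts at the pullback along this composite, which has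
    to be \<open>idm X\<close> for \<open>u U s\<close> to be a section there.\<close>
  have idm: "compose (topspace X) (idm X) (idm X) = idm X"
    by (auto simp: compose_def)
  have "(\<Union>(V, t)\<in>?u U s z. germ X ?I (idm X z) {y \<in> topspace X. idm X y \<in> V}
      (inv_image_unit X X (idm X) F V t)) = germ X ?I z U (?u U s)" if z: "z \<in> U" for z
  proof -
    \<comment> \<open>Here \<open>u\<close> takes the role of \<open>\<phi>\<close> in
      \<open>stalk_map\<close>: for each representative \<open>(V, t)\<close> the preimage of
      \<open>V\<close> is \<open>V\<close>, and the unit at \<open>t\<close> is
      \<open>u V t\<close>.\<close>
    have "(\<Union>(V, t)\<in>?u U s z. germ X ?I (idm X z) {y \<in> topspace X. idm X y \<in> V}
        (inv_image_unit X X (idm X) F V t)) = stalk_map X ?I ?u z (germ X F z U s)"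
      unfolding stalk_map_def
    proof (rule SUP_cong)
      show "?u U s z = germ X F z U s"
        using z by (simp add: inv_image_id_iso_apply U)
      fix Vt assume "Vt \<in> germ X F z U s"
      then show "(case Vt of (V, t) \<Rightarrow> germ X ?I (idm X z) {y \<in> topspace X. idm X y \<in> V}
          (inv_image_unit X X (idm X) F V t)) = (case Vt of (V, t) \<Rightarrow> germ X ?I z V (?u V t))"
        using U z openin_idm_apply[OF U(1) z]
        by (cases Vt) (simp add: in_germ_iff openin_idm_preimage inv_image_unit_idm
            del: restrict_apply)
    qed
    also have "\<dots> = germ X ?I z U (?u U s)"
      by (rule stalk_map_germ[OF presheaf_id_inv_image inv_image_id_iso_hom U z])
    finally show ?thesis .
  qed
  then show ?thesis
    using u U unfolding inv_image_comp_iso_def idm inv_image_id_iso_apply[OF U(1) u]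
    by (simp add: inv_image_def cong: restrict_cong)
qed

end

section \<open>Bijectivity of \<open>u\<close> for sheaves\<close>

context sheaf
begin

text \<open>Equal germs at every point of \<open>U\<close> give a cover of \<open>U\<close> by open
  sets on which \<open>s\<close> and \<open>t\<close> agree, and gluing is unique.\<close>

lemma inv_image_id_iso_inj:
  assumes "openin X U" "s \<in> sec F U" "t \<in> sec F U"
    and eq: "inv_image_id_iso X F U s = inv_image_id_iso X F U t"
  shows "s = t"
proof -
  let ?\<U> = "{W. openin X W \<and> W \<subseteq> U \<and> res F U W s = res F U W t}"
  have "\<exists>W\<in>?\<U>. y \<in> W" if "y \<in> U" for y
  proof -
    have "germ X F y U s = germ X F y U t"
      using fun_cong[OF eq, of y] that assms(1-3)
      by (simp add: inv_image_id_iso_apply)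
    then show ?thesis
      using assms that by (auto simp: germ_eq_iff)
  qed
  then have U: "\<Union>?\<U> = U" by blast
  \<comment> \<open>Both \<open>s\<close> and \<open>t\<close> glue the restrictions of
    \<open>s\<close> to this cover, so the uniqueness half of \<open>glue\<close> identifies
    them.\<close>
  have "\<exists>!r. r \<in> sec F (\<Union>?\<U>) \<and> (\<forall>W\<in>?\<U>. res F (\<Union>?\<U>) W r = res F U W s)"
  proof (rule glue)
    fix V W assume VW: "V \<in> ?\<U>" "W \<in> ?\<U>"
    then have *: "openin X V" "V \<subseteq> U" "openin X W" "W \<subseteq> U" "openin X (V \<inter> W)"
      by auto
    show "res F V (V \<inter> W) (res F U V s) = res F W (V \<inter> W) (res F U W s)"
      using res_res[OF assms(1) *(1,5) _ *(2) assms(2)] res_res[OF assms(1) *(3,5) _ *(4) assms(2)]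
      by simp
  qed (use assms(1-3) in \<open>auto simp: res_in\<close>)
  then show ?thesis
    unfolding U using assms by auto
qed

text \<open>A sheaf is its own sheafification: for surjectivity, the sections that locally represent
  \<open>\<sigma>\<close> are glued.\<close>

lemma inv_image_id_iso_bij:
  assumes U: "openin X U"
  shows "bij_betw (inv_image_id_iso X F U) (sec F U) (sec (id_inv_image X F) U)"
proof -
  let ?u = "inv_image_id_iso X F" and ?I = "id_inv_image X F"
  have "\<exists>t\<in>sec F U. ?u U t = \<sigma>" if \<sigma>: "\<sigma> \<in> sec ?I U" for \<sigma>
  proof -
    \<comment> \<open>\<open>P W t\<close> means that \<open>t\<close> represents
      \<open>\<sigma>\<close> over \<open>W\<close>. The family \<open>\<U>\<close> collects all
      open subsets of \<open>U\<close> with a representative and \<open>s\<close> chooses one for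
      each, because \<open>glue\<close> takes families indexed by the open sets themselves.\<close>
    define P where "P W t \<longleftrightarrow> t \<in> sec F W \<and> ?u W t = restrict \<sigma> W" for W t
    define \<U> where "\<U> = {W. openin X W \<and> W \<subseteq> U \<and> (\<exists>t. P W t)}"
    define s where "s W = (SOME t. P W t)" for W
    have \<U>: "openin X W" "W \<subseteq> U" "s W \<in> sec F W" "?u W (s W) = restrict \<sigma> W" if "W \<in> \<U>" for W
    proof -
      have "P W (s W)"
        using that unfolding s_def \<U>_def by (auto intro: someI)
      then show "openin X W" "W \<subseteq> U" "s W \<in> sec F W" "?u W (s W) = restrict \<sigma> W"
        using that by (auto simp: P_def \<U>_def)
    qed
    have cover: "\<exists>W\<in>\<U>. y \<in> W" if y: "y \<in> U" for y
    proof -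
      obtain W t where W: "openin X W" "y \<in> W" "W \<subseteq> U" "t \<in> sec F W"
          "\<forall>z\<in>W. \<sigma> z = germ X F z W t"
        using \<sigma> y unfolding sec_id_inv_image_iff[OF U] by blast
      then have "P W t"
        by (auto simp: P_def inv_image_id_iso_apply restrict_def fun_eq_iff)
      then show ?thesis
        using W by (auto simp: \<U>_def)
    qed
    then have UN: "\<Union>\<U> = U"
      using \<U> by blast
    \<comment> \<open>Representing \<open>\<sigma>\<close> passes to smaller open sets, because
      restriction preserves germs.\<close>
    have u_res: "?u W (res F V W t) = restrict \<sigma> W"
      if "?u V t = restrict \<sigma> V" "t \<in> sec F V" "openin X V" "openin X W" "W \<subseteq> V" for V W t
    proof (rule extensionalityI[of _ W])
      fix z assume "z \<in> W"
      then have z: "z \<in> W" "z \<in> V" using that by auto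
      then have "germ X F z V t = \<sigma> z"
        using that(2,3) fun_cong[OF that(1), of z] by (simp add: inv_image_id_iso_apply)
      then show "?u W (res F V W t) z = restrict \<sigma> W z"
        using that(2-5) z by (simp add: inv_image_id_iso_apply germ_res res_in)
    qed (use that in \<open>simp_all add: inv_image_id_iso_apply res_in\<close>)
    have "\<exists>!t. t \<in> sec F (\<Union>\<U>) \<and> (\<forall>W\<in>\<U>. res F (\<Union>\<U>) W t = s W)"
    proof (rule glue)
      fix V W assume VW: "V \<in> \<U>" "W \<in> \<U>"
      have o: "openin X (V \<inter> W)"
        using \<U> VW by auto
      \<comment> \<open>Both sides are sent by \<open>u\<close> to the restriction of
        \<open>\<sigma>\<close> to \<open>V \<inter> W\<close>, and \<open>u\<close> is
        injective.\<close>
      show "res F V (V \<inter> W) (s V) = res F W (V \<inter> W) (s W)"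
        by (rule inv_image_id_iso_inj[OF o]) (use \<U> VW o in \<open>auto simp: u_res res_in\<close>)
    qed (use \<U> in auto)
    then obtain t where t: "t \<in> sec F U" "\<And>W. W \<in> \<U> \<Longrightarrow> res F U W t = s W"
      unfolding UN by blast
    have "?u U t = \<sigma>"
    proof (rule extensionalityI[of _ U])
      show "\<sigma> \<in> extensional U"
        using \<sigma> unfolding sec_id_inv_image_iff[OF U] by blast
      show "?u U t \<in> extensional U"
        using t U by (simp add: inv_image_id_iso_apply)
      fix y assume y: "y \<in> U"
      then obtain W where W: "W \<in> \<U>" "y \<in> W"
        using cover by blast
      have "?u U t y = germ X F y W (s W)"
        using W t U y \<U>(1,2)[OF W(1)] germ_res[of U W t y] by (simp add: inv_image_id_iso_apply)
      also have "\<dots> = \<sigma> y"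
        using W(2) \<U>(1-3)[OF W(1)] fun_cong[OF \<U>(4)[OF W(1)], of y] by (simp add: inv_image_id_iso_apply)
      finally show "?u U t y = \<sigma> y" .
    qed
    with t show ?thesis by blast
  qed
  then have "sec ?I U \<subseteq> ?u U ` sec F U"
    by blast
  moreover have "inj_on (?u U) (sec F U)"
    by (rule inj_onI) (use U inv_image_id_iso_inj in blast)
  ultimately show ?thesis
    unfolding bij_betw_def using sheaf_hom_in[OF inv_image_id_iso_hom U] by blast
qed

lemma bij_sheaf_hom_inv_image_id_iso:
  "bij_sheaf_hom X F (id_inv_image X F) (inv_image_id_iso X F)"
  by (simp add: bij_sheaf_hom_def bij_sheaf_hom_axioms_def presheaf_axioms presheaf_id_inv_image
      inv_image_id_iso_hom inv_image_id_iso_bij del: restrict_apply)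

end


section \<open>Sheaves on a constant simplicial space\<close>

text \<open>These are the structure maps of the cosimplicial sheaf associated with \<open>F\<close>;
  unlike \<open>strmap\<close>, they compose by plain composition.\<close>

definition trans_map ::
  "'x topology \<Rightarrow> ('x, 'a) simp_sheaf_data \<Rightarrow> nat \<Rightarrow> nat \<Rightarrow> (nat \<Rightarrow> nat) \<Rightarrow> 'x set \<Rightarrow> 'a \<Rightarrow> 'a" where
  "trans_map X F p q \<alpha> = sheaf_comp X (level F p) (strmap F p q \<alpha>) (inv_image_id_iso X (level F p))"

lemma trans_map_apply:
  "openin X U \<Longrightarrow> s \<in> sec (level F p) U
    \<Longrightarrow> trans_map X F p q \<alpha> U s = strmap F p q \<alpha> U (inv_image_id_iso X (level F p) U s)"
  by (simp add: trans_map_def sheaf_comp_apply)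

lemma const_simplicial_simps [simp]:
  "on_obj (const_simplicial X) p = X" "on_hom (const_simplicial X) q p \<alpha> = idm X"
  by (simp_all add: const_simplicial_def)

lemma level_pullback_const [simp]:
  "level_pullback (const_simplicial X) F p q \<alpha> = id_inv_image X (level F p)"
  by (simp add: level_pullback_def del: restrict_apply)

text \<open>Counterpart of \<open>sheaf_comp_eq_iff\<close> for a left side not written as a
  composite; membership in \<open>sheaf_hom\<close> supplies its \<open>undefined\<close>
  values.\<close>

lemma hom_eq_comp_iff:
  assumes "\<phi> \<in> sheaf_hom X F G"
  shows "\<phi> = sheaf_comp X F \<psi> \<chi> \<longleftrightarrow> (\<forall>U s. openin X U \<longrightarrow> s \<in> sec F U \<longrightarrow> \<phi> U s = \<psi> U (\<chi> U s))"
    (is "_ \<longleftrightarrow> ?r")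
proof
  assume ?r
  show "\<phi> = sheaf_comp X F \<psi> \<chi>"
  proof (intro ext)
    fix U s
    show "\<phi> U s = sheaf_comp X F \<psi> \<chi> U s"
      using assms \<open>?r\<close>
      by (cases "openin X U"; cases "s \<in> sec F U")
        (auto simp: sheaf_hom_def PiE_iff extensional_def sheaf_comp_def compose_def)
  qed
qed (simp add: sheaf_comp_apply)

text \<open>Every section of \<open>id^* F\<close> has the form \<open>u U s\<close>, by
  bijectivity. Conditions on structure maps thereby become conditions on sections of
  \<open>F\<close>.\<close>

lemma (in sheaf) all_sec_id_inv_image_iff:
  "(\<forall>U \<sigma>. openin X U \<longrightarrow> \<sigma> \<in> sec (id_inv_image X F) U \<longrightarrow> P U \<sigma>) \<longleftrightarrow>
   (\<forall>U s. openin X U \<longrightarrow> s \<in> sec F U \<longrightarrow> P U (inv_image_id_iso X F U s))"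
proof -
  have "(\<forall>\<sigma>\<in>sec (id_inv_image X F) U. P U \<sigma>) \<longleftrightarrow>
      (\<forall>s\<in>sec F U. P U (inv_image_id_iso X F U s))" if "openin X U" for U
    unfolding bij_betw_imp_surj_on[OF inv_image_id_iso_bij[OF that], symmetric] by (rule ball_simps)
  then show ?thesis
    unfolding Ball_def by metis
qed

lemma strmap_ident_const_iff:
  "sheaf_comp X (level F p) (strmap F p p \<alpha>) (inv_image_id_iso X (level F p)) =
     sheaf_id X (level F p) \<longleftrightarrow>
   (\<forall>U s. openin X U \<longrightarrow> s \<in> sec (level F p) U \<longrightarrow> trans_map X F p p \<alpha> U s = s)"
  by (auto simp: sheaf_comp_eq_id_iff trans_map_apply)

text \<open>Both sides are evaluated at \<open>u U s\<close>. The coherence isomorphism applies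
  \<open>u\<close> once more, naturality of \<open>u\<close> turns the result into \<open>u\<close>
  of \<open>trans_map X F p q \<alpha> U s\<close>, and \<open>strmap F q r \<beta>\<close> after
  \<open>u\<close> is the next transition map.\<close>

lemma strmap_cmp_const_iff:
  assumes "sheaf X (level F p)" "sheaf X (level F q)"
    and "strmap F p q \<alpha> \<in> sheaf_hom X (id_inv_image X (level F p)) (level F q)"
    and \<gamma>: "strmap F p r \<gamma> \<in> sheaf_hom X (id_inv_image X (level F p)) (level F r)"
  shows "strmap F p r \<gamma> =
      sheaf_comp X (id_inv_image X (level F p)) (strmap F q r \<beta>)
        (sheaf_comp X (id_inv_image X (level F p))
          (inv_image_map X X (idm X) (id_inv_image X (level F p)) (level F q) (strmap F p q \<alpha>))
          (inv_image_comp_iso X X X (idm X) (idm X) (level F p))) \<longleftrightarrow>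
    (\<forall>U s. openin X U \<longrightarrow> s \<in> sec (level F p) U \<longrightarrow>
      trans_map X F p r \<gamma> U s = trans_map X F q r \<beta> U (trans_map X F p q \<alpha> U s))"
proof -
  interpret p: sheaf X "level F p" by fact
  interpret q: sheaf X "level F q" by fact
  note u = sheaf_hom_in[OF p.inv_image_id_iso_hom]
  show ?thesis
    unfolding hom_eq_comp_iff[OF \<gamma>] p.all_sec_id_inv_image_iff
    using assms(3)
    by (simp add: sheaf_comp_apply u p.inv_image_comp_iso_id_iso sheaf_hom_in trans_map_apply
        presheaf.inv_image_map_id_iso[OF p.presheaf_id_inv_image q.presheaf_axioms] del: restrict_apply)
qed

text \<open>Introduction rule in cosimplicial terms: functoriality is asked of the transition maps,
  where no coherence isomorphism appears.\<close>

lemma simp_sheaf_constI: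
  assumes sh: "\<And>p. sheaf X (level F p)"
    and undef: "\<And>p q \<alpha>. \<alpha> \<notin> hom simplex_cat p q \<Longrightarrow> strmap F p q \<alpha> = undefined"
    and hom: "\<And>p q \<alpha>. \<alpha> \<in> hom simplex_cat p q
      \<Longrightarrow> strmap F p q \<alpha> \<in> sheaf_hom X (id_inv_image X (level F p)) (level F q)"
    and id: "\<And>p U s. openin X U \<Longrightarrow> s \<in> sec (level F p) U
      \<Longrightarrow> trans_map X F p p (ident simplex_cat p) U s = s"
    and cmp: "\<And>p q r \<alpha> \<beta> U s. \<alpha> \<in> hom simplex_cat p q \<Longrightarrow> \<beta> \<in> hom simplex_cat q r
      \<Longrightarrow> openin X U \<Longrightarrow> s \<in> sec (level F p) U \<Longrightarrow> trans_map X F p r (cmp simplex_cat p q r \<beta> \<alpha>) U s =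
        trans_map X F q r \<beta> U (trans_map X F p q \<alpha> U s)"
  shows "simp_sheaf (const_simplicial X) F"
proof (rule simp_sheaf.intro)
  fix p q r \<alpha> \<beta>
  assume *: "\<alpha> \<in> hom simplex_cat p q" "\<beta> \<in> hom simplex_cat q r"
  then have "cmp simplex_cat p q r \<beta> \<alpha> \<in> hom simplex_cat p r"
    by (intro category.cmp_hom[OF category_simplex_cat]) (auto simp: simplex_cat_def)
  from strmap_cmp_const_iff[OF sh sh hom[OF *(1)] hom[OF this], of \<beta>]
  show "strmap F p r (cmp simplex_cat p q r \<beta> \<alpha>) =
          (let P = level_pullback (const_simplicial X) F p r (cmp simplex_cat p q r \<beta> \<alpha>) in
           sheaf_comp (on_obj (const_simplicial X) r) P (strmap F q r \<beta>)
             (sheaf_comp (on_obj (const_simplicial X) r) P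
               (inv_image_map (on_obj (const_simplicial X) r) (on_obj (const_simplicial X) q)
                 (on_hom (const_simplicial X) r q \<beta>)
                 (level_pullback (const_simplicial X) F p q \<alpha>) (level F q) (strmap F p q \<alpha>))
               (inv_image_comp_iso (on_obj (const_simplicial X) r) (on_obj (const_simplicial X) q)
                 (on_obj (const_simplicial X) p)
                 (on_hom (const_simplicial X) r q \<beta>) (on_hom (const_simplicial X) q p \<alpha>) (level F p))))"
    using cmp[OF *] by (simp add: Let_def del: restrict_apply)
next
  show "sheaf (on_obj (const_simplicial X) p) (level F p)" for p
    using sh by simp
  show "strmap F p q \<alpha> = undefined" if "\<alpha> \<notin> hom simplex_cat p q" for p q \<alpha>
    using undef that .
  show "strmap F p q \<alpha> \<in> sheaf_hom (on_obj (const_simplicial X) q)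
      (level_pullback (const_simplicial X) F p q \<alpha>) (level F q)"
    if "\<alpha> \<in> hom simplex_cat p q" for p q \<alpha>
    unfolding const_simplicial_simps level_pullback_const using hom that .
  show "sheaf_comp (on_obj (const_simplicial X) p) (level F p) (strmap F p p (ident simplex_cat p))
      (inv_image_id_iso (on_obj (const_simplicial X) p) (level F p)) =
      sheaf_id (on_obj (const_simplicial X) p) (level F p)" for p
    unfolding const_simplicial_simps strmap_ident_const_iff using id by blast
qed

section \<open>Transition maps of a sheaf on the constant simplicial space\<close>

locale const_simp_sheaf = simp_sheaf "const_simplicial X" F
  for X :: "'x topology" and F :: "('x, 'a) simp_sheaf_data"
begin

sublocale level: sheaf X "level F p" for p
  using level_sheaf[of p] by simp

lemma strmap_const_hom:
  "\<alpha> \<in> hom simplex_cat p q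
    \<Longrightarrow> strmap F p q \<alpha> \<in> sheaf_hom X (id_inv_image X (level F p)) (level F q)"
  using strmap_hom[of \<alpha> p q] by (simp del: restrict_apply)

lemma trans_map_hom:
  "\<alpha> \<in> hom simplex_cat p q \<Longrightarrow> trans_map X F p q \<alpha> \<in> sheaf_hom X (level F p) (level F q)"
  unfolding trans_map_def
  by (rule sheaf_comp_hom[OF level.presheaf_axioms level.inv_image_id_iso_hom strmap_const_hom])

lemma trans_map_ident:
  "openin X U \<Longrightarrow> s \<in> sec (level F p) U \<Longrightarrow> trans_map X F p p (ident simplex_cat p) U s = s"
  using strmap_ident[of p] by (simp add: strmap_ident_const_iff)

lemma trans_map_cmp:
  assumes "\<alpha> \<in> hom simplex_cat p q" "\<beta> \<in> hom simplex_cat q r" "openin X U" "s \<in> sec (level F p) U"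
  shows "trans_map X F p r (cmp simplex_cat p q r \<beta> \<alpha>) U s =
    trans_map X F q r \<beta> U (trans_map X F p q \<alpha> U s)"
proof -
  have "cmp simplex_cat p q r \<beta> \<alpha> \<in> hom simplex_cat p r"
    using assms by (intro category.cmp_hom[OF category_simplex_cat]) (auto simp: simplex_cat_def)
  from strmap_cmp_const_iff[OF level.sheaf_axioms level.sheaf_axioms strmap_const_hom[OF assms(1)]
      strmap_const_hom[OF this], of \<beta>]
  show ?thesis
    using strmap_cmp[OF assms(1,2)] assms(3,4) by (simp add: Let_def del: restrict_apply)
qed

text \<open>A transition map is \<open>u\<close> followed by a structure map. Both are bijective on
  sections, the first for any sheaf, the second by strict cartesianness.\<close>

lemma trans_map_bij:
  assumes "strictly_cartesian (const_simplicial X) F" "\<alpha> \<in> hom simplex_cat p q" "openin X U"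
  shows "bij_betw (trans_map X F p q \<alpha> U) (sec (level F p) U) (sec (level F q) U)"
proof -
  have "sheaf_iso X (id_inv_image X (level F p)) (level F q) (strmap F p q \<alpha>)"
    using assms by (simp add: strictly_cartesian_def del: restrict_apply)
  from bij_betw_trans[OF level.inv_image_id_iso_bij[OF assms(3)] sheaf_iso_bij[OF this assms(3)]]
  show ?thesis
    by (rule bij_betw_cong[THEN iffD1, rotated]) (simp add: trans_map_apply assms)
qed

end

section \<open>Morphisms and the categories they form\<close>

text \<open>After precomposition with \<open>u\<close>, naturality of \<open>u\<close> replaces the
  pullback of \<open>\<phi> p\<close> by \<open>\<phi> p\<close> itself. So these are the morphisms
  of the associated cosimplicial sheaves.\<close>

lemma simp_sheaf_hom_const_iff:
  assumes "const_simp_sheaf X F" "const_simp_sheaf X G"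
  shows "\<phi> \<in> simp_sheaf_hom (const_simplicial X) F G \<longleftrightarrow>
    (\<forall>p. \<phi> p \<in> sheaf_hom X (level F p) (level G p)) \<and>
    (\<forall>p q. \<forall>\<alpha>\<in>hom simplex_cat p q. \<forall>U s. openin X U \<longrightarrow> s \<in> sec (level F p) U \<longrightarrow>
      \<phi> q U (trans_map X F p q \<alpha> U s) = trans_map X G p q \<alpha> U (\<phi> p U s))"
proof -
  interpret F: const_simp_sheaf X F by fact
  interpret G: const_simp_sheaf X G by fact
  have eq: "sheaf_comp X (id_inv_image X (level F p)) (\<phi> q) (strmap F p q \<alpha>) =
      sheaf_comp X (id_inv_image X (level F p)) (strmap G p q \<alpha>)
        (inv_image_map X X (idm X) (level F p) (level G p) (\<phi> p)) \<longleftrightarrow>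
    (\<forall>U s. openin X U \<longrightarrow> s \<in> sec (level F p) U \<longrightarrow>
      \<phi> q U (trans_map X F p q \<alpha> U s) = trans_map X G p q \<alpha> U (\<phi> p U s))"
    if "\<phi> p \<in> sheaf_hom X (level F p) (level G p)" for p q \<alpha>
    unfolding sheaf_comp_eq_iff F.level.all_sec_id_inv_image_iff
    using that by (simp add: F.level.inv_image_map_id_iso[OF G.level.presheaf_axioms that]
        sheaf_hom_in trans_map_apply del: restrict_apply)
  show ?thesis
    unfolding simp_sheaf_hom_def const_simplicial_simps level_pullback_const mem_Collect_eq
    by (rule conj_cong[OF refl]) (simp only: eq)
qed

text \<open>Identities and composites are formed level by level, so the category laws are those of
  \<open>Sh X\<close>; what remains is that identities and composites respect the transition
  maps.\<close>

lemma category_Sh_simp_const: "category (Sh_simp (const_simplicial X))" (is "category ?C")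
proof -
  have obj: "F \<in> obj ?C \<longleftrightarrow> const_simp_sheaf X F" for F :: "('a, 'b) simp_sheaf_data"
    by (simp add: Sh_simp_def const_simp_sheaf_def)
  have homD: "f p \<in> hom (Sh X) (level F p) (level G p)" if "f \<in> hom ?C F G" for F G f p
    using that by (auto simp: Sh_simp_def Sh_def simp_sheaf_hom_def simp del: restrict_apply)
  have level: "level F p \<in> obj (Sh X)" if "F \<in> obj ?C" for F :: "('a, 'b) simp_sheaf_data" and p
    using that const_simp_sheaf.axioms(1) simp_sheaf.level_sheaf by (fastforce simp: obj Sh_def)
  have ident: "ident ?C F = (\<lambda>p. ident (Sh X) (level F p))" for F
    by (simp add: Sh_simp_def Sh_def)
  have cmp: "cmp ?C F G H g f =
      (\<lambda>p. cmp (Sh X) (level F p) (level G p) (level H p) (g p) (f p))" for F G H g f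
    by (simp add: Sh_simp_def Sh_def)
  interpret Sh: category "Sh X" by (rule category_Sh)
  show ?thesis
  proof
    fix F assume "F \<in> obj ?C"
    then interpret const_simp_sheaf X F by (simp add: obj)
    show "ident ?C F \<in> hom ?C F F"
      using simp_sheaf_hom_const_iff[OF const_simp_sheaf_axioms const_simp_sheaf_axioms]
      by (simp add: Sh_simp_def level.sheaf_id_hom sheaf_id_apply sheaf_hom_in[OF trans_map_hom])
  next
    fix F G H f g
    assume "F \<in> obj ?C" "G \<in> obj ?C" "H \<in> obj ?C" and f: "f \<in> hom ?C F G" and g: "g \<in> hom ?C G H"
    then interpret F: const_simp_sheaf X F + G: const_simp_sheaf X G + H: const_simp_sheaf X H
      by (simp_all add: obj)
    have f: "f \<in> simp_sheaf_hom (const_simplicial X) F G"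
      and g: "g \<in> simp_sheaf_hom (const_simplicial X) G H"
      using f g by (simp_all add: Sh_simp_def)
    have fp: "f p \<in> sheaf_hom X (level F p) (level G p)"
      and gp: "g p \<in> sheaf_hom X (level G p) (level H p)" for p
      using f g by (simp_all add: simp_sheaf_hom_def)
    show "cmp ?C F G H g f \<in> hom ?C F H"
      using f g unfolding Sh_simp_def cat_data.simps
        simp_sheaf_hom_const_iff[OF F.const_simp_sheaf_axioms G.const_simp_sheaf_axioms]
        simp_sheaf_hom_const_iff[OF G.const_simp_sheaf_axioms H.const_simp_sheaf_axioms]
        simp_sheaf_hom_const_iff[OF F.const_simp_sheaf_axioms H.const_simp_sheaf_axioms]
      by (simp add: sheaf_comp_hom[OF F.level.presheaf_axioms fp gp] sheaf_comp_apply
          sheaf_hom_in[OF F.trans_map_hom] sheaf_hom_in[OF fp])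
  qed (simp_all add: ident cmp homD level Sh.cmp_ident_left Sh.cmp_ident_right Sh.cmp_assoc)
qed

lemma category_full_subcat:
  assumes "category C"
  shows "category (full_subcat C P)"
proof -
  interpret category C by fact
  show ?thesis
    by unfold_locales (auto simp: full_subcat_def
        intro: ident_hom cmp_hom cmp_ident_left cmp_ident_right cmp_assoc)
qed

lemma category_Sh_scart_const: "category (Sh_scart (const_simplicial X))"
  unfolding Sh_scart_def by (rule category_full_subcat[OF category_Sh_simp_const])

lemma obj_Sh_scart_const:
  "F \<in> obj (Sh_scart (const_simplicial X)) \<longleftrightarrow>
    const_simp_sheaf X F \<and> strictly_cartesian (const_simplicial X) F"
  by (simp add: Sh_scart_def full_subcat_def Sh_simp_def const_simp_sheaf_def)

lemma Sh_scart_const_simps: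
  "hom (Sh_scart (const_simplicial X)) = simp_sheaf_hom (const_simplicial X)"
  "ident (Sh_scart (const_simplicial X)) = (\<lambda>F p. sheaf_id X (level F p))"
  "cmp (Sh_scart (const_simplicial X)) = (\<lambda>F G H \<psi> \<phi> p. sheaf_comp X (level F p) (\<psi> p) (\<phi> p))"
  by (simp_all add: Sh_scart_def full_subcat_def Sh_simp_def)

text \<open>The levelwise inverses commute with the transition maps because \<open>\<phi>\<close>
  does, and the homs of the full subcategory are those of \<open>Sh_simp\<close>.\<close>

lemma iso_in_Sh_scart_const:
  assumes F: "const_simp_sheaf X F" and G: "const_simp_sheaf X G"
    and \<phi>: "\<phi> \<in> simp_sheaf_hom (const_simplicial X) F G"
    and bij: "\<And>p U. openin X U \<Longrightarrow> bij_betw (\<phi> p U) (sec (level F p) U) (sec (level G p) U)"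
  shows "iso_in (Sh_scart (const_simplicial X)) F G \<phi>"
proof -
  interpret F: const_simp_sheaf X F by fact
  interpret G: const_simp_sheaf X G by fact
  note \<phi>' = \<phi>[unfolded simp_sheaf_hom_const_iff[OF F G]]
  interpret p: bij_sheaf_hom X "level F p" "level G p" "\<phi> p" for p
    by unfold_locales (use \<phi>' bij in auto)
  define \<psi> where "\<psi> p = sheaf_inv X (level F p) (level G p) (\<phi> p)" for p
  have nat: "\<psi> q U (trans_map X G p q \<alpha> U s) = trans_map X F p q \<alpha> U (\<psi> p U s)"
    if *: "\<alpha> \<in> hom simplex_cat p q" "openin X U" "s \<in> sec (level G p) U" for p q \<alpha> U s
  proof -
    have s: "\<psi> p U s \<in> sec (level F p) U"
      using * by (simp add: \<psi>_def p.inv_in)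
    \<comment> \<open>Inserting \<open>\<phi> p\<close> after \<open>\<psi> p\<close> lets the
      compatibility of \<open>\<phi>\<close> apply; \<open>\<psi> q\<close> then cancels
      \<open>\<phi> q\<close>.\<close>
    have "trans_map X G p q \<alpha> U s = trans_map X G p q \<alpha> U (\<phi> p U (\<psi> p U s))"
      using * by (simp add: \<psi>_def p.inv_right)
    also have "\<dots> = \<phi> q U (trans_map X F p q \<alpha> U (\<psi> p U s))"
      using \<phi>' * s by simp
    finally show ?thesis
      using * s by (simp add: \<psi>_def p.inv_left sheaf_hom_in[OF F.trans_map_hom])
  qed
  have "\<psi> \<in> simp_sheaf_hom (const_simplicial X) G F"
    unfolding simp_sheaf_hom_const_iff[OF G F] using nat p.inv_hom by (simp add: \<psi>_def)
  moreover have "sheaf_comp X (level F p) (\<psi> p) (\<phi> p) = sheaf_id X (level F p)"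
    "sheaf_comp X (level G p) (\<phi> p) (\<psi> p) = sheaf_id X (level G p)" for p
    by (simp_all add: sheaf_comp_eq_id_iff \<psi>_def p.inv_left p.inv_right)
  ultimately show ?thesis
    using \<phi> unfolding iso_in_def Sh_scart_const_simps by blast
qed


section \<open>The equivalence\<close>

text \<open>The structure maps invert \<open>u\<close>, as \<open>id^* A\<close> is only isomorphic
  to \<open>A\<close>; the transition maps then become identities. The value
  \<open>undefined\<close> off the homs is demanded by \<open>simp_sheaf\<close>.\<close>

definition const_sheaf :: "'x topology \<Rightarrow> ('x, 'a) presheaf_data \<Rightarrow> ('x, 'a) simp_sheaf_data" where
  "const_sheaf X A = \<lparr>level = (\<lambda>p. A),
     strmap = (\<lambda>p q \<alpha>. if \<alpha> \<in> hom simplex_cat p q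
       then sheaf_inv X A (id_inv_image X A) (inv_image_id_iso X A) else undefined)\<rparr>"

lemma level_const_sheaf [simp]: "level (const_sheaf X A) p = A"
  by (simp add: const_sheaf_def)

context sheaf
begin

interpretation u: bij_sheaf_hom X F "id_inv_image X F" "inv_image_id_iso X F"
  by (rule bij_sheaf_hom_inv_image_id_iso)

lemma trans_map_const_sheaf:
  assumes "\<alpha> \<in> hom simplex_cat p q" "openin X U" "s \<in> sec F U"
  shows "trans_map X (const_sheaf X F) p q \<alpha> U s = s"
  using assms by (simp add: trans_map_apply) (simp add: const_sheaf_def u.inv_left del: restrict_apply)

lemma const_simp_sheaf_const_sheaf: "const_simp_sheaf X (const_sheaf X F)"
proof (rule const_simp_sheaf.intro, rule simp_sheaf_constI)
  fix p q \<alpha>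
  assume "\<alpha> \<in> hom simplex_cat p q"
  then show "strmap (const_sheaf X F) p q \<alpha> \<in>
      sheaf_hom X (id_inv_image X (level (const_sheaf X F) p)) (level (const_sheaf X F) q)"
    using u.inv_hom by (simp add: const_sheaf_def del: restrict_apply)
next
  fix p U s
  assume "openin X U" "s \<in> sec (level (const_sheaf X F) p) U"
  moreover have "ident simplex_cat p \<in> hom simplex_cat p p"
    by (intro category.ident_hom[OF category_simplex_cat]) (simp add: simplex_cat_def)
  ultimately show "trans_map X (const_sheaf X F) p p (ident simplex_cat p) U s = s"
    by (simp add: trans_map_const_sheaf)
next
  fix p q r \<alpha> \<beta> U s
  assume *: "\<alpha> \<in> hom simplex_cat p q" "\<beta> \<in> hom simplex_cat q r" "openin X U"
    "s \<in> sec (level (const_sheaf X F) p) U"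
  moreover have "cmp simplex_cat p q r \<beta> \<alpha> \<in> hom simplex_cat p r"
    using * by (intro category.cmp_hom[OF category_simplex_cat]) (auto simp: simplex_cat_def)
  ultimately show "trans_map X (const_sheaf X F) p r (cmp simplex_cat p q r \<beta> \<alpha>) U s =
      trans_map X (const_sheaf X F) q r \<beta> U (trans_map X (const_sheaf X F) p q \<alpha> U s)"
    by (simp add: trans_map_const_sheaf)
qed (simp_all add: sheaf_axioms, simp add: const_sheaf_def)

lemma strictly_cartesian_const_sheaf:
  "strictly_cartesian (const_simplicial X) (const_sheaf X F)"
  using bij_sheaf_hom.iso[OF u.inv_bij_sheaf_hom]
  by (simp add: strictly_cartesian_def del: restrict_apply)
    (simp add: const_sheaf_def del: restrict_apply)

end

section \<open>Maps out of level 0\<close>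

context const_simp_sheaf
begin

text \<open>Independence of the vertex is what will make \<open>counit\<close> compatible with all
  transition maps.\<close>

lemma trans_map_from_0_unique:
  assumes cart: "strictly_cartesian (const_simplicial X) F"
    and \<alpha>: "\<alpha> \<in> hom simplex_cat 0 p" and \<beta>: "\<beta> \<in> hom simplex_cat 0 p"
    and Us: "openin X U" "s \<in> sec (level F 0) U"
  shows "trans_map X F 0 p \<alpha> U s = trans_map X F 0 p \<beta> U s"
proof -
  define \<sigma> :: "nat \<Rightarrow> nat" where "\<sigma> = (\<lambda>i\<in>{..p}. 0)"
  have \<sigma>: "\<sigma> \<in> hom simplex_cat p 0"
    by (auto simp: \<sigma>_def simplex_cat_def mono_on_def)
  have "trans_map X F p 0 \<sigma> U (trans_map X F 0 p \<gamma> U s) = s" if \<gamma>: "\<gamma> \<in> hom simplex_cat 0 p" for \<gamma>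
  proof -
    \<comment> \<open>\<open>[0]\<close> is terminal in the simplex category, so its only
      endomorphism is the identity.\<close>
    have "cmp simplex_cat 0 p 0 \<sigma> \<gamma> = ident simplex_cat 0"
      using \<gamma> by (auto simp: \<sigma>_def simplex_cat_def compose_def fun_eq_iff)
    then show ?thesis
      using trans_map_cmp[OF \<gamma> \<sigma> Us] trans_map_ident[OF Us] by simp
  qed
  \<comment> \<open>The map of \<open>\<sigma>\<close> sends both values to \<open>s\<close>; strict
    cartesianness makes it injective.\<close>
  moreover have "inj_on (trans_map X F p 0 \<sigma> U) (sec (level F p) U)"
    using trans_map_bij[OF cart \<sigma> Us(1)] by (simp add: bij_betw_def)
  ultimately show ?thesis
    using \<alpha> \<beta> Us by (metis inj_onD sheaf_hom_in trans_map_hom)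
qed

end

text \<open>The arrow from \<open>[0]\<close> to \<open>[p]\<close> with image 0. Arrows carry no
  codomain, so one function serves for every \<open>p\<close>.\<close>

definition vertex0 :: "nat \<Rightarrow> nat" where
  "vertex0 = (\<lambda>i\<in>{..0}. 0)"

lemma vertex0_hom: "vertex0 \<in> hom simplex_cat 0 p"
  by (auto simp: vertex0_def simplex_cat_def mono_on_def)

definition counit ::
  "'x topology \<Rightarrow> ('x, 'a) simp_sheaf_data \<Rightarrow> nat \<Rightarrow> 'x set \<Rightarrow> 'a \<Rightarrow> 'a" where
  "counit X F p = trans_map X F 0 p vertex0"

text \<open>Bijectivity comes from strict cartesianness, compatibility with the transition maps from
  independence of the vertex.\<close>

lemma (in const_simp_sheaf) counit_iso:
  assumes cart: "strictly_cartesian (const_simplicial X) F"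
  shows "iso_in (Sh_scart (const_simplicial X)) (const_sheaf X (level F 0)) F (counit X F)"
proof (rule iso_in_Sh_scart_const)
  show c: "const_simp_sheaf X (const_sheaf X (level F 0))"
    by (rule level.const_simp_sheaf_const_sheaf)
  show "const_simp_sheaf X F" ..
  have "counit X F q U s = trans_map X F p q \<alpha> U (counit X F p U s)"
    if *: "\<alpha> \<in> hom simplex_cat p q" "openin X U" "s \<in> sec (level F 0) U" for p q \<alpha> U s
  proof -
    \<comment> \<open>\<open>\<alpha>\<close> need not fix 0, so this composite may be a vertex of
      \<open>[q]\<close> other than \<open>vertex0\<close>; both induce the same map.\<close>
    have "cmp simplex_cat 0 p q \<alpha> vertex0 \<in> hom simplex_cat 0 q"
      using * vertex0_hom
      by (intro category.cmp_hom[OF category_simplex_cat]) (auto simp: simplex_cat_def)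
    from trans_map_from_0_unique[OF cart vertex0_hom this *(2,3)] show ?thesis
      by (simp add: counit_def trans_map_cmp[OF vertex0_hom] *)
  qed
  then show "counit X F \<in> simp_sheaf_hom (const_simplicial X) (const_sheaf X (level F 0)) F"
    unfolding simp_sheaf_hom_const_iff[OF c const_simp_sheaf_axioms]
    by (simp add: level.trans_map_const_sheaf) (simp add: counit_def trans_map_hom vertex0_hom)
  show "bij_betw (counit X F p U) (sec (level (const_sheaf X (level F 0)) p) U) (sec (level F p) U)"
    if "openin X U" for p U
    using trans_map_bij[OF cart vertex0_hom that] by (simp add: counit_def)
qed

section \<open>The two functors\<close>

definition const_functor ::
  "'x topology \<Rightarrow> (('x, 'a) presheaf_data, 'x set \<Rightarrow> 'a \<Rightarrow> 'a,
    ('x, 'a) simp_sheaf_data, nat \<Rightarrow> 'x set \<Rightarrow> 'a \<Rightarrow> 'a) functor_data" where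
  "const_functor X = \<lparr>on_obj = const_sheaf X, on_hom = (\<lambda>A B \<phi> p. \<phi>)\<rparr>"

definition level0_functor ::
  "(('x, 'a) simp_sheaf_data, nat \<Rightarrow> 'x set \<Rightarrow> 'a \<Rightarrow> 'a,
    ('x, 'a) presheaf_data, 'x set \<Rightarrow> 'a \<Rightarrow> 'a) functor_data" where
  "level0_functor = \<lparr>on_obj = (\<lambda>F. level F 0), on_hom = (\<lambda>F G \<phi>. \<phi> 0)\<rparr>"

text \<open>All transition maps of constant sheaves are identities, so the family equal to
  \<open>\<phi>\<close> at every level is compatible with them.\<close>

lemma cat_functor_const: "cat_functor (Sh X) (Sh_scart (const_simplicial X)) (const_functor X)"
proof (rule cat_functor.intro[OF category_Sh category_Sh_scart_const], unfold_locales)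
  fix A assume "A \<in> obj (Sh X)"
  then interpret A: sheaf X A by (simp add: Sh_def)
  show "on_obj (const_functor X) A \<in> obj (Sh_scart (const_simplicial X))"
    using A.const_simp_sheaf_const_sheaf A.strictly_cartesian_const_sheaf
    by (simp add: obj_Sh_scart_const const_functor_def)
  fix B \<phi> assume "B \<in> obj (Sh X)" "\<phi> \<in> hom (Sh X) A B"
  then interpret B: sheaf X B by (simp add: Sh_def)
  have "\<phi> \<in> sheaf_hom X A B"
    using \<open>\<phi> \<in> hom (Sh X) A B\<close> by (simp add: Sh_def)
  then show "on_hom (const_functor X) A B \<phi> \<in>
      hom (Sh_scart (const_simplicial X)) (on_obj (const_functor X) A) (on_obj (const_functor X) B)"
    using simp_sheaf_hom_const_iff[OF A.const_simp_sheaf_const_sheaf B.const_simp_sheaf_const_sheaf]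
    by (simp add: Sh_scart_const_simps const_functor_def A.trans_map_const_sheaf
        B.trans_map_const_sheaf sheaf_hom_in)
qed (simp_all add: const_functor_def Sh_scart_const_simps Sh_def)

lemma cat_functor_level0: "cat_functor (Sh_scart (const_simplicial X)) (Sh X) level0_functor"
proof (rule cat_functor.intro[OF category_Sh_scart_const category_Sh], unfold_locales)
  fix F assume "F \<in> obj (Sh_scart (const_simplicial X))"
  then interpret const_simp_sheaf X F by (simp add: obj_Sh_scart_const)
  show "on_obj level0_functor F \<in> obj (Sh X)"
    by (simp add: level0_functor_def Sh_def level.sheaf_axioms)
qed (simp_all add: level0_functor_def Sh_scart_const_simps Sh_def simp_sheaf_hom_def
    del: restrict_apply)

text \<open>Level 0 of a constant sheaf is the given sheaf itself and not just isomorphic to it, so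
  the unit can be the identity.\<close>

lemma level0_const_functor: "comp_functor level0_functor (const_functor X) = id_functor"
  by (simp add: comp_functor_def level0_functor_def const_functor_def id_functor_def)

lemma cat_functor_comp:
  assumes "cat_functor C D F" "cat_functor D E G"
  shows "cat_functor C E (comp_functor G F)"
proof -
  interpret F: cat_functor C D F by fact
  interpret G: cat_functor D E G by fact
  show ?thesis
    by unfold_locales (simp_all add: comp_functor_def F.on_obj_obj G.on_obj_obj F.on_hom_hom
        G.on_hom_hom F.on_hom_ident G.on_hom_ident F.on_hom_cmp G.on_hom_cmp)
qed

lemma cat_functor_id: "category C \<Longrightarrow> cat_functor C C id_functor"
  by (simp add: cat_functor_def cat_functor_axioms_def id_functor_def)

lemma (in category) nat_iso_id: "nat_iso C C id_functor id_functor (ident C)"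
proof (intro nat_iso.intro cat_functor_id category_axioms nat_iso_axioms.intro)
  fix a assume "a \<in> obj C"
  then show "iso_in C (on_obj id_functor a) (on_obj id_functor a) (ident C a)"
    using ident_hom cmp_ident_left by (auto simp: id_functor_def iso_in_def)
qed (simp add: id_functor_def cmp_ident_left cmp_ident_right)

theorem lemma2p15:
  fixes X :: "'x topology"
  shows "equivalent_categories
           (Sh X :: (('x, 'a) presheaf_data, 'x set \<Rightarrow> 'a \<Rightarrow> 'a) cat_data)
           (Sh_scart (const_simplicial X) ::
              (('x, 'a) simp_sheaf_data, nat \<Rightarrow> 'x set \<Rightarrow> 'a \<Rightarrow> 'a) cat_data)"
proof -
  let ?C = "Sh X :: (('x, 'a) presheaf_data, 'x set \<Rightarrow> 'a \<Rightarrow> 'a) cat_data"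
  let ?D = "Sh_scart (const_simplicial X) ::
    (('x, 'a) simp_sheaf_data, nat \<Rightarrow> 'x set \<Rightarrow> 'a \<Rightarrow> 'a) cat_data"
  have unit: "nat_iso ?C ?C id_functor (comp_functor level0_functor (const_functor X)) (ident ?C)"
    unfolding level0_const_functor by (rule category.nat_iso_id[OF category_Sh])
  have "nat_iso ?D ?D (comp_functor (const_functor X) level0_functor) id_functor (counit X)"
  proof (intro nat_iso.intro cat_functor_id category_Sh_scart_const nat_iso_axioms.intro
      cat_functor_comp[OF cat_functor_level0 cat_functor_const])
    fix F assume "F \<in> obj ?D"
    then have F: "const_simp_sheaf X F" "strictly_cartesian (const_simplicial X) F"
      by (simp_all add: obj_Sh_scart_const)
    then show "iso_in ?D (on_obj (comp_functor (const_functor X) level0_functor) F)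
        (on_obj id_functor F) (counit X F)"
      by (simp add: comp_functor_def const_functor_def level0_functor_def id_functor_def
          const_simp_sheaf.counit_iso)
    fix G \<phi> assume "G \<in> obj ?D" and \<phi>: "\<phi> \<in> hom ?D F G"
    then have G: "const_simp_sheaf X G"
      by (simp add: obj_Sh_scart_const)
    interpret F: const_simp_sheaf X F by fact
    \<comment> \<open>Naturality of the counit is the compatibility of \<open>\<phi>\<close> with
      the transition map of \<open>vertex0\<close>.\<close>
    have nat: "\<phi> p U (counit X F p U s) = counit X G p U (\<phi> 0 U s)"
      if "openin X U" "s \<in> sec (level F 0) U" for p U s
      using \<phi> that vertex0_hom simp_sheaf_hom_const_iff[OF F(1) G]
      by (simp add: Sh_scart_const_simps counit_def)
    have "sheaf_comp X (level F 0) (counit X G p) (\<phi> 0) =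
        sheaf_comp X (level F 0) (\<phi> p) (counit X F p)" for p
      unfolding sheaf_comp_eq_iff using nat by simp
    then show "cmp ?D (on_obj (comp_functor (const_functor X) level0_functor) F)
        (on_obj (comp_functor (const_functor X) level0_functor) G) (on_obj id_functor G)
        (counit X G) (on_hom (comp_functor (const_functor X) level0_functor) F G \<phi>) =
      cmp ?D (on_obj (comp_functor (const_functor X) level0_functor) F)
        (on_obj id_functor F) (on_obj id_functor G) (on_hom id_functor F G \<phi>) (counit X F)"
      by (simp add: comp_functor_def const_functor_def level0_functor_def id_functor_def
          Sh_scart_const_simps)
  qed
  with unit show ?thesis
    unfolding equivalent_categories_def using cat_functor_const cat_functor_level0 by blast
qed

end
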